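(* Let $m(n)$ and $h(n)$ be computable functions such that $m(n) < n$ for all $n$ and $h(n) = \omega(\log \frac{n}{m(n)})$. There exists a computable function $E : \{0,1\}^n \times \{0,1\}^{h(n)} \to \{0,1\}^{m(n)}$ such that for every $x \in \{0,1\}^n$ with $C(x \mid n) \geq m(n)$ there exists $\alpha_x \in \{0,1\}^{h(n)}$ such that $C(E(x,\alpha_x) \mid m(n)) \geq m(n) - o(m(n))$.
   Context: $C(u \mid v)$ is plain conditional Kolmogorov complexity with respect to a fixed universal Turing machine. $E$ denotes an ensemble of functions, one for each $n$, computable as a function of $(n, x, \alpha)$. Asymptotic notation is as $n \to \infty$. *)

theory Defs
  imports Complex_Main "HOL-Library.Landau_Symbols"
begin

section \<open>Partial recursive functions\<close>

datatype recf =
    Zero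
  | Succ
  | Proj nat
  | Comp recf "recf list"
  | PrimRec recf recf
  | Mu recf

text \<open>
  \<open>evals f xs y\<close>: the partial recursive function denoted by \<open>f\<close> is defined on the
  argument tuple \<open>xs\<close> and has value \<open>y\<close> there.  Terms carry no arity: the \<open>k\<close>-ary function
  denoted by \<open>f\<close> is obtained by restricting to \<open>length xs = k\<close>, and ill-formed applications
  are undefined.
\<close>

inductive evals :: "recf \<Rightarrow> nat list \<Rightarrow> nat \<Rightarrow> bool" where
  zero: "evals Zero xs 0"
| succ: "evals Succ [x] (Suc x)"
| proj: "i < length xs \<Longrightarrow> evals (Proj i) xs (xs ! i)"
| comp: "list_all2 (\<lambda>g y. evals g xs y) gs ys \<Longrightarrow> evals f ys z \<Longrightarrow> evals (Comp f gs) xs z"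
| primrec_0: "evals f xs y \<Longrightarrow> evals (PrimRec f g) (0 # xs) y"
| primrec_Suc: "evals (PrimRec f g) (k # xs) y \<Longrightarrow> evals g (k # y # xs) z
    \<Longrightarrow> evals (PrimRec f g) (Suc k # xs) z"
| mu: "evals f (k # xs) 0 \<Longrightarrow> (\<forall>i<k. \<exists>y>0. evals f (i # xs) y) \<Longrightarrow> evals (Mu f) xs k"
monos list_all2_mono

lemma evals_det: "evals f xs y \<Longrightarrow> evals f xs z \<Longrightarrow> y = z"
proof (induction f xs y arbitrary: z rule: evals.induct)
  case (zero xs)
  then show ?case by (auto elim: evals.cases)
next
  case (succ x)
  then show ?case by (auto elim: evals.cases)
next
  case (proj i xs)
  from proj.prems show ?case by (auto elim: evals.cases)
next
  case (comp xs gs ys f z z')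
  from comp.prems obtain ys' where
    ys': "list_all2 (\<lambda>g y. evals g xs y) gs ys'" "evals f ys' z'"
    by (auto elim: evals.cases)
  have "ys = ys'"
    using comp.IH(1) ys'(1) by (auto simp: list_all2_conv_all_nth intro!: nth_equalityI)
  then show ?case using comp.IH(2) ys'(2) by blast
next
  case (primrec_0 f xs y g)
  from primrec_0.prems have "evals f xs z" by (auto elim: evals.cases)
  then show ?case by (rule primrec_0.IH)
next
  case (primrec_Suc f g k xs y z z')
  from primrec_Suc.prems obtain y' where "evals (PrimRec f g) (k # xs) y'"
    and "evals g (k # y' # xs) z'"
    by (auto elim: evals.cases)
  then show ?case using primrec_Suc.IH by blast
next
  case (mu f k xs k')
  from mu.prems have k': "evals f (k' # xs) 0" "\<forall>i<k'. \<exists>y>0. evals f (i # xs) y"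
    by (auto elim: evals.cases)
  show ?case
  proof (rule linorder_cases[of k k'])
    assume "k < k'"
    then show ?thesis using k'(2) mu.IH(1) by blast
  next
    assume "k' < k"
    then show ?thesis using k'(1) mu.IH(2) by blast
  qed
qed

section \<open>Binary strings and computability\<close>

type_synonym str = "bool list"

text \<open>Bijective base-2 numeration, least significant digit first.\<close>

fun code :: "str \<Rightarrow> nat" where
  "code [] = 0"
| "code (b # bs) = 2 * code bs + (if b then 2 else 1)"

lemma inj_code: "inj code"
proof (rule injI)
  show "code x = code y \<Longrightarrow> x = y" for x y
  proof (induction x arbitrary: y)
    case Nil
    then show ?case by (cases y) (auto split: if_splits)
  next
    case (Cons b x)
    then show ?case by (cases y) (auto split: if_splits, presburger+)
  qed
qed

lemma surj_code: "surj code"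
proof -
  have "\<exists>x. code x = n" for n
  proof (induction n rule: less_induct)
    case (less n)
    show ?case
    proof (cases "n = 0")
      case True
      then show ?thesis by (metis code.simps(1))
    next
      case False
      then have "(n - 1) div 2 < n" by linarith
      then obtain x where x: "code x = (n - 1) div 2"
        using less by blast
      from False have "code (even n # x) = n"
        unfolding code.simps x by (cases "even n") (simp_all, presburger+)
      then show ?thesis by blast
    qed
  qed
  then show ?thesis by (metis surjI)
qed

definition str_of_nat :: "nat \<Rightarrow> str" where
  "str_of_nat = inv code"

definition computable_nat :: "(nat \<Rightarrow> nat) \<Rightarrow> bool" where
  "computable_nat g \<longleftrightarrow> (\<exists>f. \<forall>n. evals f [n] (g n))"

definition computable_ensemble :: "(nat \<Rightarrow> str \<Rightarrow> str \<Rightarrow> str) \<Rightarrow> bool" where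
  "computable_ensemble E \<longleftrightarrow>
     (\<exists>f. \<forall>n x \<alpha>. evals f [n, code x, code \<alpha>] (code (E n x \<alpha>)))"

section \<open>Plain conditional Kolmogorov complexity\<close>

text \<open>A machine maps a program and a condition to an output, if it halts.\<close>

type_synonym machine = "str \<Rightarrow> str \<Rightarrow> str option"

definition partial_computable :: "machine \<Rightarrow> bool" where
  "partial_computable M \<longleftrightarrow>
     (\<exists>f. \<forall>p v u. M p v = Some u \<longleftrightarrow> evals f [code p, code v] (code u))"

text \<open>
  Universality in the sense of the invariance theorem.  It holds in particular for every machine
  that simulates each machine \<open>M\<close> on program \<open>p\<close> when run on \<open>w\<^sub>M @ p\<close> for a fixed
  string \<open>w\<^sub>M\<close>.
\<close>

definition universal_machine :: "machine \<Rightarrow> bool" where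
  "universal_machine U \<longleftrightarrow> partial_computable U \<and>
     (\<forall>M. partial_computable M \<longrightarrow>
        (\<exists>c. \<forall>p v u. M p v = Some u \<longrightarrow>
           (\<exists>q. length q \<le> length p + c \<and> U q v = Some u)))"

definition kolmogorov :: "machine \<Rightarrow> str \<Rightarrow> str \<Rightarrow> nat" where
  "kolmogorov U u v = (LEAST k. \<exists>p. length p = k \<and> U p v = Some u)"

text \<open>For a universal machine the minimum is over a nonempty set.\<close>

lemma universal_machine_has_program:
  assumes "universal_machine U"
  shows "\<exists>p. U p v = Some u"
proof -
  have "partial_computable (\<lambda>p v. Some p)"
    unfolding partial_computable_def
  proof (intro exI allI)
    fix p v u :: str
    have *: "evals (Proj 0) [code p, code v] (code p)"
      using evals.proj[of 0 "[code p, code v]"] by simp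
    show "Some p = Some u \<longleftrightarrow> evals (Proj 0) [code p, code v] (code u)"
      using * evals_det[OF *] inj_code by (auto dest: injD)
  qed
  then show ?thesis
    using assms unfolding universal_machine_def by blast
qed

end

theory Submission
  imports Defs "HOL-Library.Nat_Bijection" "HOL-Library.FuncSet"
begin

text \<open>
  Fix a constant \<open>d\<close>.  For each \<open>n\<close> the function \<open>E\<close> is the first table in a brute-force search for
  the dispersion property with the smallest possible loss \<open>r\<close>: for every set \<open>B\<close> of fewer than
  \<open>2^(m-r)\<close> outputs, at most \<open>2^(m-d)\<close> inputs are mapped into \<open>B\<close> by all advice strings.  Let \<open>B\<close>
  consist of the outputs of complexity less than \<open>m - r\<close>.  Then the trapped inputs are enumerable
  given \<open>n\<close>, so each of them is described by its index in the enumeration, written with exactly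
  \<open>m - d\<close> bits; the decoder recovers \<open>d\<close> as \<open>m(n)\<close> minus the program length and hence does not depend
  on \<open>d\<close>.  Choosing \<open>d\<close> larger than the constant of the invariance theorem makes the trapped inputs
  simpler than \<open>m\<close>.

  The loss is \<open>o(m)\<close> because three kinds of functions bound it: if \<open>m \<le> h\<close>, copying the advice
  has loss \<open>0\<close>; truncation to \<open>m\<close> bits has loss at most \<open>n - m + d\<close>; and a random function has
  loss at most \<open>r\<close> as soon as \<open>d \<le> r\<close> and \<open>n + m < r 2^h\<close>.
\<close>

subsection \<open>Closure properties of computable functions and decidable predicates\<close>

lemma evals_comp1: "evals g xs y \<Longrightarrow> evals f [y] z \<Longrightarrow> evals (Comp f [g]) xs z"
  by (rule evals.comp[where ys = "[y]"]) auto

lemma evals_comp2: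
  "evals g xs y \<Longrightarrow> evals g' xs y' \<Longrightarrow> evals f [y, y'] z \<Longrightarrow> evals (Comp f [g, g']) xs z"
  by (rule evals.comp[where ys = "[y, y']"]) auto

lemma evals_comp3:
  "evals g xs y \<Longrightarrow> evals g' xs y' \<Longrightarrow> evals g'' xs y'' \<Longrightarrow> evals f [y, y', y''] z \<Longrightarrow>
    evals (Comp f [g, g', g'']) xs z"
  by (rule evals.comp[where ys = "[y, y', y'']"]) auto

lemma evals_Proj: "i < length xs \<Longrightarrow> xs ! i = y \<Longrightarrow> evals (Proj i) xs y"
  using evals.proj by blast

lemma evals_PrimRec:
  assumes "evals f xs (F 0)" and "\<And>i. evals g (i # F i # xs) (F (Suc i))"
  shows "evals (PrimRec f g) (k # xs) (F k)"
  by (induction k) (auto intro: evals.intros assms)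

lemma computable_natI: "(\<And>n. evals f [n] (g n)) \<Longrightarrow> computable_nat g"
  unfolding computable_nat_def by blast

definition computable2 :: "(nat \<Rightarrow> nat \<Rightarrow> nat) \<Rightarrow> bool" where
  "computable2 f \<longleftrightarrow> (\<exists>F. \<forall>x y. evals F [x, y] (f x y))"

lemma computable2I: "(\<And>x y. evals F [x, y] (f x y)) \<Longrightarrow> computable2 f"
  unfolding computable2_def by blast

lemma computable2_comp1:
  assumes "computable_nat f" "computable2 g"
  shows "computable2 (\<lambda>x y. f (g x y))"
proof -
  obtain F G where "\<And>n. evals F [n] (f n)" "\<And>x y. evals G [x, y] (g x y)"
    using assms unfolding computable_nat_def computable2_def by blast
  then show ?thesis by (intro computable2I[of "Comp F [G]"] evals_comp1)
qed

lemma computable2_comp2: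
  assumes "computable2 f" "computable2 g" "computable2 g'"
  shows "computable2 (\<lambda>x y. f (g x y) (g' x y))"
proof -
  obtain F G G' where "\<And>x y. evals F [x, y] (f x y)" "\<And>x y. evals G [x, y] (g x y)"
    "\<And>x y. evals G' [x, y] (g' x y)"
    using assms unfolding computable2_def by blast
  then show ?thesis by (intro computable2I[of "Comp F [G, G']"] evals_comp2)
qed

lemma computable2_fst: "computable2 (\<lambda>x y. x)"
  by (rule computable2I[of "Proj 0"]) (simp add: evals_Proj)

lemma computable2_snd: "computable2 (\<lambda>x y. y)"
  by (rule computable2I[of "Proj 1"]) (simp add: evals_Proj)

lemma computable_comp:
  assumes "computable_nat f" "computable_nat g"
  shows "computable_nat (\<lambda>z. f (g z))"
proof -
  obtain F G where "\<And>n. evals F [n] (f n)" "\<And>n. evals G [n] (g n)"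
    using assms unfolding computable_nat_def by blast
  then show ?thesis by (intro computable_natI[of "Comp F [G]"] evals_comp1)
qed

lemma computable_comp2:
  assumes "computable2 f" "computable_nat g" "computable_nat g'"
  shows "computable_nat (\<lambda>z. f (g z) (g' z))"
proof -
  obtain F G G' where "\<And>x y. evals F [x, y] (f x y)" "\<And>n. evals G [n] (g n)"
    "\<And>n. evals G' [n] (g' n)"
    using assms unfolding computable_nat_def computable2_def by blast
  then show ?thesis by (intro computable_natI[of "Comp F [G, G']"] evals_comp2)
qed

lemma computable_id: "computable_nat (\<lambda>z. z)"
  by (rule computable_natI[of "Proj 0"]) (simp add: evals_Proj)

lemma computable_Suc: "computable_nat f \<Longrightarrow> computable_nat (\<lambda>z. Suc (f z))"
  using computable_comp[of Suc] computable_natI[of Succ] evals.succ by blast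

lemma computable_const: "computable_nat (\<lambda>z. c)"
  by (induction c) (auto intro: computable_natI[of Zero] evals.zero computable_Suc)

lemma computable2_primrec:
  assumes "computable_nat f" "\<And>x. F 0 x = f x"
    and "computable2 g" "\<And>k x. F (Suc k) x = g (F k x) x"
  shows "computable2 F"
proof -
  obtain P Q where P: "\<And>n. evals P [n] (f n)" and Q: "\<And>x y. evals Q [x, y] (g x y)"
    using assms(1,3) unfolding computable_nat_def computable2_def by blast
  have "evals (PrimRec P (Comp Q [Proj 1, Proj 2])) [k, x] (F k x)" for k x
    by (rule evals_PrimRec)
      (auto simp: assms(2,4) evals_Proj intro!: P evals_comp2 Q)
  then show ?thesis by (rule computable2I)
qed

lemma computable2_add: "computable2 (+)"
  by (rule computable2_primrec[where f = "\<lambda>x. x" and g = "\<lambda>r x. Suc r"])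
    (use computable_id computable2_comp1[OF computable_Suc[OF computable_id] computable2_fst] in simp_all)

lemma computable2_mult: "computable2 (*)"
  by (rule computable2_primrec[where f = "\<lambda>x. 0" and g = "\<lambda>r x. r + x"])
    (auto intro: computable_const computable2_add)

lemma computable2_swap: "computable2 f \<Longrightarrow> computable2 (\<lambda>x y. f y x)"
  by (rule computable2_comp2[OF _ computable2_snd computable2_fst])

lemma computable2_power: "computable2 (^)"
proof -
  have "computable2 (\<lambda>k x. x ^ k)"
    by (rule computable2_primrec[where f = "\<lambda>x. 1" and g = "\<lambda>r x. r * x"])
      (auto intro: computable_const computable2_mult)
  then show ?thesis by (rule computable2_swap)
qed

lemma computable_unary_primrec:
  assumes "computable2 g" "\<And>k. F (Suc k) = g k (F k)"
  shows "computable_nat F"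
proof -
  obtain P where P: "\<And>n. evals P [n] (F 0)"
    using computable_const[of "F 0"] unfolding computable_nat_def by blast
  obtain Q where Q: "\<And>x y. evals Q [x, y] (g x y)"
    using assms(1) unfolding computable2_def by blast
  \<comment> \<open>The second argument is a dummy that gives the base term \<open>P\<close> one
    argument; evaluation on the diagonal removes it afterwards.\<close>
  have "computable2 (\<lambda>k x. F k)"
  proof (rule computable2I)
    show "evals (PrimRec P (Comp Q [Proj 0, Proj 1])) [k, x] (F k)" for k x
      by (rule evals_PrimRec) (auto simp: assms(2) evals_Proj intro!: P evals_comp2 Q)
  qed
  from computable_comp2[OF this computable_id computable_id] show ?thesis by simp
qed

lemma computable_pred: "computable_nat (\<lambda>n. n - 1)"
  by (rule computable_unary_primrec[where g = "\<lambda>x y. x"]) (simp_all add: computable2_fst)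

lemma computable2_diff: "computable2 (-)"
proof -
  have "computable2 (\<lambda>k x. x - k)"
    by (rule computable2_primrec[where f = "\<lambda>x. x" and g = "\<lambda>r x. r - 1"])
      (auto simp del: One_nat_def intro: computable_id computable2_fst computable2_comp1[OF computable_pred])
  then show ?thesis by (rule computable2_swap)
qed

lemmas computable_add = computable_comp2[OF computable2_add]
lemmas computable_mult = computable_comp2[OF computable2_mult]
lemmas computable_power = computable_comp2[OF computable2_power]
lemmas computable_diff = computable_comp2[OF computable2_diff]

lemma computable_triangle: "computable_nat triangle"
  by (rule computable_unary_primrec[where g = "\<lambda>k r. r + Suc k"])
    (auto intro!: computable2_comp2[OF computable2_add] computable2_comp1[of Suc]
      computable2_fst computable2_snd computable_Suc computable_id)

section \<open>Cantor pairing and computability on tuples\<close>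

definition pair :: "nat \<Rightarrow> nat \<Rightarrow> nat" where
  "pair x y = prod_encode (x, y)"

definition pfst :: "nat \<Rightarrow> nat" where
  "pfst z = fst (prod_decode z)"

definition psnd :: "nat \<Rightarrow> nat" where
  "psnd z = snd (prod_decode z)"

lemma pfst_pair [simp]: "pfst (pair x y) = x"
  and psnd_pair [simp]: "psnd (pair x y) = y"
  and pair_pfst_psnd [simp]: "pair (pfst z) (psnd z) = z"
  by (simp_all add: pair_def pfst_def psnd_def)

lemma pair_eq: "pair x y = triangle (x + y) + x"
  by (simp add: pair_def prod_encode_def)

text \<open>\<open>Mu F\<close> halts only if \<open>F\<close> returns positive values below the
  result; totality of \<open>f\<close> and minimality supply them.\<close>

lemma computable2_Least_zero:
  assumes "computable2 f" and ex: "\<And>z. \<exists>k. f k z = 0"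
  shows "computable_nat (\<lambda>z. LEAST k. f k z = 0)"
proof -
  obtain F where F: "\<And>x y. evals F [x, y] (f x y)"
    using assms(1) unfolding computable2_def by blast
  show ?thesis
  proof (rule computable_natI[of "Mu F"], rule evals.mu)
    fix z
    have *: "f (LEAST k. f k z = 0) z = 0" by (rule LeastI_ex[OF ex])
    show "evals F [LEAST k. f k z = 0, z] 0"
      using F[of "LEAST k. f k z = 0" z] unfolding * .
    show "\<forall>i<LEAST k. f k z = 0. \<exists>y>0. evals F [i, z] y"
      using F not_less_Least by blast
  qed
qed

lemma mono_triangle: "x \<le> y \<Longrightarrow> triangle x \<le> triangle y"
  by (induction rule: dec_induct) auto

text \<open>\<open>pair x y\<close> lies on the diagonal numbered \<open>x + y\<close>, which starts
  at \<open>triangle (x + y)\<close>. The diagonal \<open>s z\<close> is found by unbounded search,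
  and subtraction then yields both components.\<close>

lemma computable_pfst_psnd: "computable_nat pfst" "computable_nat psnd"
proof -
  \<comment> \<open>With truncated subtraction the equation says
    \<open>z < triangle (Suc k)\<close>.\<close>
  define s where "s z = (LEAST k. Suc z - triangle (Suc k) = 0)" for z
  have bound: "z < triangle (Suc z)" for z by (induction z) auto
  have "computable2 (\<lambda>k z. Suc z - triangle (Suc k))"
    by (intro computable2_comp2[OF computable2_diff] computable2_comp1[of Suc] computable2_comp1[OF computable_triangle]
        computable2_fst computable2_snd computable_Suc computable_id)
  moreover have "\<exists>k. Suc z - triangle (Suc k) = 0" for z
    using bound[of z] by (intro exI[of _ z]) simp
  ultimately have s: "computable_nat s"
    unfolding s_def by (rule computable2_Least_zero)
  have s_pair: "s (pair x y) = x + y" for x y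
    unfolding s_def
  proof (rule Least_equality)
    show "Suc (pair x y) - triangle (Suc (x + y)) = 0" by (simp add: pair_eq)
    fix k assume "Suc (pair x y) - triangle (Suc k) = 0"
    then have "triangle (x + y) < triangle (Suc k)" by (simp add: pair_eq)
    then show "x + y \<le> k" by (meson mono_triangle not_less_eq_eq linorder_not_less)
  qed
  have pair_s: "pair x y - triangle (s (pair x y)) = x" for x y
    by (simp add: s_pair) (simp add: pair_eq)
  have pfst: "pfst = (\<lambda>z. z - triangle (s z))"
    by (rule ext) (metis pair_s pair_pfst_psnd)
  have psnd: "psnd = (\<lambda>z. s z - pfst z)"
    by (rule ext) (metis s_pair pair_pfst_psnd add_diff_cancel_left')
  show "computable_nat pfst"
    unfolding pfst by (intro computable_diff computable_id computable_comp[OF computable_triangle s])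
  then show "computable_nat psnd"
    by (subst psnd) (intro computable_diff s)
qed

lemmas computable_pfst = computable_comp[OF computable_pfst_psnd(1)]
lemmas computable_psnd = computable_comp[OF computable_pfst_psnd(2)]

lemma computable_pair:
  "computable_nat f \<Longrightarrow> computable_nat g \<Longrightarrow> computable_nat (\<lambda>z. pair (f z) (g z))"
  unfolding pair_eq by (intro computable_add computable_comp[OF computable_triangle])

text \<open>Passes from unary computability on nested pairs, where the closure rules live, to a term
  with three separate arguments, as recursion, machines and ensembles require.\<close>

lemma computable3:
  assumes "computable_nat (\<lambda>w. S (pfst w) (pfst (psnd w)) (psnd (psnd w)))"
  obtains F where "\<And>x y z. evals F [x, y, z] (S x y z)"
proof -
  obtain G where G: "\<And>w. evals G [w] (S (pfst w) (pfst (psnd w)) (psnd (psnd w)))"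
    using assms unfolding computable_nat_def by blast
  obtain Q where Q: "\<And>x y. evals Q [x, y] (pair x y)"
    using computable2_comp2[OF computable2_add
        computable2_comp1[OF computable_triangle computable2_add] computable2_fst]
    unfolding pair_eq[symmetric] computable2_def by blast
  have "evals (Comp G [Comp Q [Proj 0, Comp Q [Proj 1, Proj 2]]]) [x, y, z] (S x y z)" for x y z
    using G[of "pair x (pair y z)"] Q by (auto intro!: evals_comp1 evals_comp2 evals_Proj)
  then show thesis by (rule that)
qed

lemma computable_primrec:
  assumes "computable_nat b" "computable_nat c"
    and "computable_nat (\<lambda>w. S (pfst w) (pfst (psnd w)) (psnd (psnd w)))"
  shows "computable_nat (\<lambda>z. rec_nat (b z) (\<lambda>i a. S i a z) (c z))"
proof -
  obtain B where B: "\<And>z. evals B [z] (b z)"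
    using assms(1) unfolding computable_nat_def by blast
  obtain G where G: "\<And>i a z. evals G [i, a, z] (S i a z)"
    using computable3[OF assms(3)] by blast
  have "evals (PrimRec B G) [k, z] (rec_nat (b z) (\<lambda>i a. S i a z) k)" for k z
    by (rule evals_PrimRec) (simp_all add: B G)
  from computable_comp2[OF computable2I[OF this] assms(2) computable_id] show ?thesis .
qed

section \<open>Decidable predicates, bounded quantifiers and division\<close>

definition decidable :: "(nat \<Rightarrow> bool) \<Rightarrow> bool" where
  "decidable P \<longleftrightarrow> computable_nat (\<lambda>z. if P z then 1 else 0)"

lemma decidable_comp: "decidable P \<Longrightarrow> computable_nat g \<Longrightarrow> decidable (\<lambda>z. P (g z))"
  unfolding decidable_def by (rule computable_comp)

lemma computable_If:
  assumes "decidable P" "computable_nat f" "computable_nat g"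
  shows "computable_nat (\<lambda>z. if P z then f z else g z)"
proof -
  have "(\<lambda>z. if P z then f z else g z) =
    (\<lambda>z. (if P z then 1 else 0) * f z + (1 - (if P z then 1 else 0)) * g z)" by auto
  with assms show ?thesis unfolding decidable_def
    by (auto intro!: computable_add computable_mult computable_diff computable_const)
qed

lemma decidable_not: "decidable P \<Longrightarrow> decidable (\<lambda>z. \<not> P z)"
proof -
  assume P: "decidable P"
  have "(\<lambda>z. if \<not> P z then 1 else 0) = (\<lambda>z. if P z then 0 else (1::nat))" by auto
  then show "decidable (\<lambda>z. \<not> P z)"
    using computable_If[OF P computable_const computable_const, of 0 1]
    unfolding decidable_def by simp
qed

lemma decidable_conj:
  assumes "decidable P" "decidable Q" shows "decidable (\<lambda>z. P z \<and> Q z)"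
proof -
  have "(\<lambda>z. if P z \<and> Q z then 1 else 0) = (\<lambda>z. if P z then (if Q z then 1 else (0::nat)) else 0)"
    by auto
  with assms computable_If[OF assms(1) _ computable_const] show ?thesis
    unfolding decidable_def by simp
qed

lemma decidable_disj: "decidable P \<Longrightarrow> decidable Q \<Longrightarrow> decidable (\<lambda>z. P z \<or> Q z)"
  using decidable_not[OF decidable_conj[OF decidable_not decidable_not], of P Q] by simp

lemma decidable_imp: "decidable P \<Longrightarrow> decidable Q \<Longrightarrow> decidable (\<lambda>z. P z \<longrightarrow> Q z)"
  using decidable_disj[OF decidable_not, of P Q] by (simp only: imp_conv_disj)

lemma decidable_le:
  assumes "computable_nat f" "computable_nat g" shows "decidable (\<lambda>z. f z \<le> g z)"
proof -
  have "(\<lambda>z. if f z \<le> g z then 1 else 0) = (\<lambda>z. 1 - (f z - g z))" by auto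
  with assms show ?thesis unfolding decidable_def
    by (auto intro!: computable_diff computable_const simp only: )
qed

lemma decidable_less:
  "computable_nat f \<Longrightarrow> computable_nat g \<Longrightarrow> decidable (\<lambda>z. f z < g z)"
  using decidable_le[OF computable_Suc, of f g] by (simp add: Suc_le_eq)

lemma decidable_eq:
  "computable_nat f \<Longrightarrow> computable_nat g \<Longrightarrow> decidable (\<lambda>z. f z = g z)"
  using decidable_conj[OF decidable_le[of f g] decidable_le[of g f]] by (simp add: eq_iff)

lemma computable_Least:
  assumes "decidable (\<lambda>w. P (pfst w) (psnd w))" and ex: "\<And>z. \<exists>k. P k z"
  shows "computable_nat (\<lambda>z. LEAST k. P k z)"
proof -
  have "computable2 (\<lambda>x y. pair x y)"
    unfolding pair_eq by (intro computable2_comp2[OF computable2_add] computable2_comp1[OF computable_triangle]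
        computable2_add computable2_fst)
  from computable2_comp1[OF decidable_not[OF assms(1), unfolded decidable_def] this]
  have "computable2 (\<lambda>x y. if \<not> P x y then 1 else 0)" by simp
  moreover have *: "(if \<not> P k z then 1 else 0) = (0::nat) \<longleftrightarrow> P k z" for k z by simp
  ultimately show ?thesis
    using computable2_Least_zero[of "\<lambda>k z. if \<not> P k z then 1 else 0"] ex unfolding * by blast
qed

text \<open>Counting below a bound is a primitive recursion; a bounded existential quantifier then
  says that such a count is positive.\<close>

lemma computable_card:
  assumes "decidable (\<lambda>w. P (pfst w) (psnd w))" "computable_nat b"
  shows "computable_nat (\<lambda>z. card {i. i < b z \<and> P i z})"
proof -
  have card: "card {i. i < n \<and> P i z} = rec_nat 0 (\<lambda>i a. a + (if P i z then 1 else 0)) n" for n z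
  proof (induction n)
    case (Suc n)
    have "{i. i < Suc n \<and> P i z} = (if P n z then insert n {i. i < n \<and> P i z} else {i. i < n \<and> P i z})"
      by (auto simp: less_Suc_eq)
    with Suc show ?case by simp
  qed simp
  have "decidable (\<lambda>w. P (pfst w) (psnd (psnd w)))"
    using decidable_comp[OF assms(1), of "\<lambda>w. pair (pfst w) (psnd (psnd w))"]
    by (simp add: computable_pair computable_pfst computable_psnd computable_id)
  then show ?thesis unfolding card
    by (intro computable_primrec computable_const assms(2) computable_add computable_If
        computable_pfst computable_psnd computable_id)
qed

lemma decidable_bex:
  assumes "decidable (\<lambda>w. P (pfst w) (psnd w))" "computable_nat b"
  shows "decidable (\<lambda>z. \<exists>i<b z. P i z)"
proof -
  have "(\<exists>i<b z. P i z) \<longleftrightarrow> 0 < card {i. i < b z \<and> P i z}" for z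
    by (subst card_gt_0_iff) auto
  then show ?thesis
    using decidable_less[OF computable_const computable_card[OF assms], of 0] by simp
qed

lemma decidable_ball:
  assumes "decidable (\<lambda>w. P (pfst w) (psnd w))" "computable_nat b"
  shows "decidable (\<lambda>z. \<forall>i<b z. P i z)"
  using decidable_not[OF decidable_bex[OF decidable_not[OF assms(1)] assms(2)]] by simp

text \<open>The disjunct \<open>y = 0\<close> keeps the search total and makes it return 0, in
  agreement with division by zero.\<close>

lemma div_eq_Least: "(x::nat) div y = (LEAST k. y = 0 \<or> x < Suc k * y)"
proof (rule sym, rule Least_equality)
  show "y = 0 \<or> x < Suc (x div y) * y"
    by (metis dividend_less_div_times mult_Suc gr0I)
  show "y = 0 \<or> x < Suc k * y \<Longrightarrow> x div y \<le> k" for k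
    by (metis div_by_0 less_Suc_eq_le less_mult_imp_div_less zero_le)
qed

lemma computable_div:
  assumes "computable_nat f" "computable_nat g" shows "computable_nat (\<lambda>z. f z div g z)"
proof -
  have "computable_nat (\<lambda>z. pfst z div psnd z)"
    unfolding div_eq_Least
  proof (rule computable_Least)
    show "\<exists>k. psnd z = 0 \<or> pfst z < Suc k * psnd z" for z
      by (metis dividend_less_div_times mult_Suc gr0I)
  qed (intro decidable_disj decidable_eq decidable_less computable_mult computable_Suc
      computable_pfst computable_psnd computable_id computable_const)
  from computable_comp[OF this computable_pair[OF assms]] show ?thesis by simp
qed

lemma computable_mod:
  assumes "computable_nat f" "computable_nat g" shows "computable_nat (\<lambda>z. f z mod g z)"
  unfolding modulo_nat_def
  by (intro assms computable_diff computable_mult computable_div)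

lemmas computable_intros =
  computable_id computable_const computable_Suc computable_add computable_mult computable_power
  computable_diff computable_div computable_mod computable_pair computable_pfst computable_psnd
  computable_card computable_If decidable_not decidable_conj decidable_disj decidable_imp
  decidable_eq decidable_less decidable_le decidable_bex decidable_ball

section \<open>Digits as codes of finite sequences\<close>

definition dig :: "nat \<Rightarrow> nat \<Rightarrow> nat \<Rightarrow> nat" where
  "dig b e j = e div b ^ j mod b"

lemma computable_dig:
  "computable_nat b \<Longrightarrow> computable_nat e \<Longrightarrow> computable_nat j \<Longrightarrow>
    computable_nat (\<lambda>z. dig (b z) (e z) (j z))"
  unfolding dig_def by (intro computable_intros)

text \<open>Each further entry becomes a new leading digit. The bound on \<open>e\<close> turns
  quantification over tables and over sets of outputs into bounded search.\<close>

lemma ex_dig: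
  assumes "\<And>j. j < N \<Longrightarrow> g j < b"
  shows "\<exists>e<b ^ N. \<forall>j<N. dig b e j = g j"
  using assms
proof (induction N)
  case (Suc N)
  then obtain e where e: "e < b ^ N" "\<And>j. j < N \<Longrightarrow> dig b e j = g j" by auto
  have gN: "g N < b" using Suc.prems by simp
  have "e + g N * b ^ N < b ^ N * Suc (g N)" using e(1) by simp
  also have "\<dots> \<le> b ^ N * b" using gN by (intro mult_le_mono2) simp
  finally have *: "e + g N * b ^ N < b ^ Suc N" by (simp add: mult.commute)
  have "dig b (e + g N * b ^ N) j = g j" if "j < Suc N" for j
  proof (cases "j = N")
    case True
    then show ?thesis using e(1) gN by (simp add: dig_def)
  next
    case False
    with that have "j < N" by simp
    then obtain k where k: "N = j + Suc k" by (metis less_imp_Suc_add add_Suc_right)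
    have "(e + g N * b ^ N) div b ^ j = e div b ^ j + g N * b ^ Suc k"
      using gN div_mult_self2[of "b ^ j" e "g N * b ^ Suc k"]
      unfolding k power_add by (simp add: ac_simps)
    then have "dig b (e + g N * b ^ N) j = dig b e j" by (simp add: dig_def mod_add_right_eq[symmetric])
    then show ?thesis using e(2) \<open>j < N\<close> by simp
  qed
  with * show ?case by blast
qed simp

text \<open>A base above the sum of all entries makes every entry a digit, so two numbers code an
  arbitrary finite sequence.\<close>

lemma ex_dig_base: "\<exists>b e. \<forall>j<N. dig b e j = g j"
proof -
  have "g j < Suc (\<Sum>i<N. g i)" if "j < N" for j
    using that by (simp add: less_Suc_eq_le member_le_sum)
  from ex_dig[of N g, OF this] show ?thesis by blast
qed

subsection \<open>Semidecidability of evaluation\<close>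

definition semidecidable :: "(nat \<Rightarrow> bool) \<Rightarrow> bool" where
  "semidecidable R \<longleftrightarrow> (\<exists>D. decidable D \<and> (\<forall>z. R z \<longleftrightarrow> (\<exists>t. D (pair t z))))"

lemma semidecidableI:
  assumes "decidable (\<lambda>w. D (pfst w) (psnd w))" "\<And>z. R z \<longleftrightarrow> (\<exists>t. D t z)"
  shows "semidecidable R"
  unfolding semidecidable_def using assms
  by (intro exI[of _ "\<lambda>w. D (pfst w) (psnd w)"]) simp

text \<open>The stage predicate is delivered closed under substitution, ready for use inside larger
  formulas.\<close>

lemma semidecidableE:
  assumes "semidecidable R"
  obtains D where "\<And>f g. computable_nat f \<Longrightarrow> computable_nat g \<Longrightarrow> decidable (\<lambda>z. D (f z) (g z))"
    "\<And>z. R z \<longleftrightarrow> (\<exists>t. D t z)"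
proof -
  obtain D where D: "decidable D" "\<And>z. R z \<longleftrightarrow> (\<exists>t. D (pair t z))"
    using assms unfolding semidecidable_def by blast
  show thesis
    by (rule that[of "\<lambda>t z. D (pair t z)"])
      (use D in \<open>auto intro: decidable_comp[OF D(1)] computable_pair\<close>)
qed

lemma semidecidable_decidable: "decidable P \<Longrightarrow> semidecidable P"
  by (rule semidecidableI[of "\<lambda>t z. P z"])
    (use decidable_comp[OF _ computable_psnd[OF computable_id], of P] in simp_all)

lemma semidecidable_comp:
  assumes "semidecidable R" "computable_nat g" shows "semidecidable (\<lambda>z. R (g z))"
proof -
  from assms(1) obtain D where "\<And>f g. computable_nat f \<Longrightarrow> computable_nat g \<Longrightarrow> decidable (\<lambda>z. D (f z) (g z))"
    "\<And>z. R z \<longleftrightarrow> (\<exists>t. D t z)" by (rule semidecidableE) blast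
  then show ?thesis
    by (intro semidecidableI[of "\<lambda>t z. D t (g z)"]) (simp_all add: computable_intros computable_comp[OF assms(2)])
qed

lemma semidecidable_ex:
  assumes "semidecidable (\<lambda>w. R (pfst w) (psnd w))" shows "semidecidable (\<lambda>z. \<exists>x. R x z)"
proof -
  from assms obtain D where D: "\<And>f g. computable_nat f \<Longrightarrow> computable_nat g \<Longrightarrow> decidable (\<lambda>z. D (f z) (g z))"
    "\<And>z. R (pfst z) (psnd z) \<longleftrightarrow> (\<exists>t. D t z)" by (rule semidecidableE) blast
  have "R x z \<longleftrightarrow> (\<exists>t. D t (pair x z))" for x z using D(2)[of "pair x z"] by simp
  then have "(\<exists>x. R x z) \<longleftrightarrow> (\<exists>t. D (psnd t) (pair (pfst t) z))" for z
    by (metis pfst_pair psnd_pair)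
  then show ?thesis
    by (intro semidecidableI[of "\<lambda>t z. D (psnd t) (pair (pfst t) z)"]) (auto intro!: D(1) computable_intros)
qed

lemma semidecidable_conj:
  assumes "semidecidable P" "semidecidable Q" shows "semidecidable (\<lambda>z. P z \<and> Q z)"
proof -
  from assms(1) obtain D where D: "\<And>f g. computable_nat f \<Longrightarrow> computable_nat g \<Longrightarrow> decidable (\<lambda>z. D (f z) (g z))"
    "\<And>z. P z \<longleftrightarrow> (\<exists>t. D t z)" by (rule semidecidableE) blast
  from assms(2) obtain D' where D': "\<And>f g. computable_nat f \<Longrightarrow> computable_nat g \<Longrightarrow> decidable (\<lambda>z. D' (f z) (g z))"
    "\<And>z. Q z \<longleftrightarrow> (\<exists>t. D' t z)" by (rule semidecidableE) blast
  have "P z \<and> Q z \<longleftrightarrow> (\<exists>t. D (pfst t) z \<and> D' (psnd t) z)" for z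
    unfolding D(2) D'(2) by (metis pfst_pair psnd_pair)
  then show ?thesis
    by (intro semidecidableI[of "\<lambda>t z. D (pfst t) z \<and> D' (psnd t) z"])
      (auto intro!: D(1) D'(1) computable_intros)
qed

text \<open>Finitely many stages have a common bound \<open>T\<close>, so the unbounded search for a
  stage moves in front of the bounded quantifier.\<close>

lemma semidecidable_ball:
  assumes "semidecidable (\<lambda>w. R (pfst w) (psnd w))" "computable_nat b"
  shows "semidecidable (\<lambda>z. \<forall>i<b z. R i z)"
proof -
  from assms(1) obtain D where D: "\<And>f g. computable_nat f \<Longrightarrow> computable_nat g \<Longrightarrow> decidable (\<lambda>z. D (f z) (g z))"
    "\<And>z. R (pfst z) (psnd z) \<longleftrightarrow> (\<exists>t. D t z)" by (rule semidecidableE) blast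
  have R: "R x z \<longleftrightarrow> (\<exists>t. D t (pair x z))" for x z using D(2)[of "pair x z"] by simp
  have "(\<forall>i<b z. R i z) \<longleftrightarrow> (\<exists>T. \<forall>i<b z. \<exists>t<T. D t (pair i z))" for z
  proof
    assume "\<forall>i<b z. R i z"
    then obtain t where "\<And>i. i < b z \<Longrightarrow> D (t i) (pair i z)" unfolding R by metis
    moreover have "t i < Suc (\<Sum>i<b z. t i)" if "i < b z" for i
      using that by (simp add: less_Suc_eq_le member_le_sum)
    ultimately show "\<exists>T. \<forall>i<b z. \<exists>t<T. D t (pair i z)" by blast
  qed (auto simp: R)
  then show ?thesis
    by (intro semidecidableI[of "\<lambda>T z. \<forall>i<b z. \<exists>t<T. D t (pair i z)"])
      (auto intro!: D(1) computable_intros computable_comp[OF assms(2)])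
qed

lemmas semidecidable_intros = semidecidable_conj semidecidable_ex semidecidable_ball

lemma list_decode_Suc: "list_decode (Suc (pair x c)) = x # list_decode c"
  by (simp add: pair_def)

text \<open>Replaces a pattern match on an argument list by an existential statement about codes,
  under which semidecidability is preserved.\<close>

lemma list_decode_eq_Cons: "list_decode c = x # xs \<longleftrightarrow> (\<exists>c'. c = Suc (pair x c') \<and> list_decode c' = xs)"
  by (metis list_decode_Suc list_encode_inverse list_decode_inverse)

text \<open>\<open>s\<close> is the history of the recursion: \<open>s i\<close> is the value after
  \<open>i\<close> rounds.\<close>

lemma evals_PrimRec_iff:
  "evals (PrimRec f g) (k # xs) y \<longleftrightarrow>
    (\<exists>s. evals f xs (s 0) \<and> (\<forall>i<k. evals g (i # s i # xs) (s (Suc i))) \<and> y = s k)"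
proof (induction k arbitrary: y)
  case 0
  have "evals (PrimRec f g) (0 # xs) y \<longleftrightarrow> evals f xs y"
    by (auto elim: evals.cases intro: evals.intros)
  then show ?case by auto
next
  case (Suc k)
  have "evals (PrimRec f g) (Suc k # xs) y \<longleftrightarrow>
      (\<exists>y'. evals (PrimRec f g) (k # xs) y' \<and> evals g (k # y' # xs) y)"
    by (auto elim: evals.cases intro: evals.intros)
  also have "\<dots> \<longleftrightarrow> (\<exists>s. (evals f xs (s 0) \<and> (\<forall>i<k. evals g (i # s i # xs) (s (Suc i))))
      \<and> evals g (k # s k # xs) y)" unfolding Suc.IH by blast
  also have "\<dots> \<longleftrightarrow> (\<exists>s. evals f xs (s 0) \<and> (\<forall>i<Suc k. evals g (i # s i # xs) (s (Suc i))) \<and> y = s (Suc k))"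
  proof safe
    fix s assume "evals f xs (s 0)" "\<forall>i<k. evals g (i # s i # xs) (s (Suc i))" "evals g (k # s k # xs) y"
    then show "\<exists>s. evals f xs (s 0) \<and> (\<forall>i<Suc k. evals g (i # s i # xs) (s (Suc i))) \<and> y = s (Suc k)"
      by (intro exI[of _ "s(Suc k := y)"]) (auto simp: less_Suc_eq)
  qed auto
  finally show ?case .
qed

text \<open>By induction on the term, evaluation is expressed through that of the subterms, with the
  intermediate values coded by numbers under existential and bounded universal quantifiers.\<close>

lemma semidecidable_evals: "semidecidable (\<lambda>z. evals f (list_decode (pfst z)) (psnd z))"
proof (induction f)
  case Zero
  have "evals Zero xs y \<longleftrightarrow> y = 0" for xs y by (auto elim: evals.cases intro: evals.intros)
  then show ?case by (simp add: semidecidable_decidable computable_intros)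
next
  case Succ
  have "evals Succ (list_decode c) y \<longleftrightarrow> (\<exists>x. c = Suc (pair x 0) \<and> y = Suc x)" for c y
  proof -
    have "evals Succ xs y \<longleftrightarrow> (\<exists>x. xs = [x] \<and> y = Suc x)" for xs
      by (auto elim: evals.cases intro: evals.intros)
    then show ?thesis
      by (auto simp: list_decode_eq_Cons) (metis list_decode.simps(1) list_decode_inverse)+
  qed
  then show ?case
    by (simp only:) (intro semidecidable_intros semidecidable_decidable computable_intros)
next
  case (Proj i)
  have "evals (Proj i) xs y \<longleftrightarrow> i < length xs \<and> xs ! i = y" for xs y
    by (auto elim: evals.cases intro: evals.intros)
  moreover have "semidecidable (\<lambda>z. i < length (list_decode (pfst z)) \<and> list_decode (pfst z) ! i = psnd z)"
  proof (induction i)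
    case 0
    have "0 < length xs \<and> xs ! 0 = y \<longleftrightarrow> (\<exists>xs'. xs = y # xs')" for xs and y :: nat by (cases xs) auto
    then have "0 < length (list_decode c) \<and> list_decode c ! 0 = y \<longleftrightarrow> (\<exists>c'. c = Suc (pair y c'))" for c y
      by (auto simp: list_decode_eq_Cons)
    then show ?case
      by (simp only:) (intro semidecidable_intros semidecidable_decidable computable_intros)
  next
    case (Suc i)
    have "Suc i < length xs \<and> xs ! Suc i = y \<longleftrightarrow> (\<exists>x xs'. xs = x # xs' \<and> i < length xs' \<and> xs' ! i = y)"
      for xs and y :: nat by (cases xs) auto
    then have "Suc i < length (list_decode c) \<and> list_decode c ! Suc i = y \<longleftrightarrow>
      (\<exists>x c'. c = Suc (pair x c') \<and> i < length (list_decode c') \<and> list_decode c' ! i = y)" for c y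
      by (auto simp: list_decode_eq_Cons) 
    moreover have IH: "semidecidable (\<lambda>z. i < length (list_decode (f z)) \<and> list_decode (f z) ! i = g z)"
      if "computable_nat f" "computable_nat g" for f g
      using semidecidable_comp[OF Suc.IH computable_pair[OF that]] by simp
    ultimately show ?case
      by (simp only:) (intro semidecidable_ex semidecidable_conj[OF semidecidable_decidable[OF decidable_eq]]
          IH computable_pfst computable_psnd computable_id computable_pair computable_Suc)
  qed
  ultimately show ?case by simp
next
  case (Comp f gs)
  have f: "semidecidable (\<lambda>z. evals f (list_decode (a z)) (b z))"
    if "computable_nat a" "computable_nat b" for a b
    using semidecidable_comp[OF Comp(1) computable_pair[OF that]] by simp
  have "semidecidable (\<lambda>z. list_all2 (\<lambda>g y. evals g (list_decode (pfst z)) y) gs (list_decode (psnd z)))"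
    using Comp(2)
  proof (induction gs)
    case Nil
    have "list_all2 P [] (list_decode c) \<longleftrightarrow> c = 0" for P :: "recf \<Rightarrow> _" and c
      by (metis list_all2_Nil list_decode.simps(1) list_decode_inverse)
    then show ?case by (simp add: semidecidable_decidable computable_intros)
  next
    case (Cons g gs)
    have g: "semidecidable (\<lambda>z. evals g (list_decode (a z)) (b z))"
      if "computable_nat a" "computable_nat b" for a b
      using semidecidable_comp[OF Cons.prems computable_pair[OF that]] by simp
    have gs: "semidecidable (\<lambda>z. list_all2 (\<lambda>g y. evals g (list_decode (a z)) y) gs (list_decode (b z)))"
      if "computable_nat a" "computable_nat b" for a b
      using semidecidable_comp[OF Cons.IH computable_pair[OF that]] Cons.prems by simp
    have "list_all2 (\<lambda>g y. evals g xs y) (g # gs) (list_decode c) \<longleftrightarrow>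
      (\<exists>y c'. c = Suc (pair y c') \<and> evals g xs y \<and> list_all2 (\<lambda>g y. evals g xs y) gs (list_decode c'))"
      for xs c
      by (auto simp: list_all2_Cons1 list_decode_eq_Cons)
    then show ?case
      by (simp only:) (intro semidecidable_intros g gs semidecidable_decidable computable_intros)
  qed
  from semidecidable_comp[OF this computable_pair]
  have gs: "semidecidable (\<lambda>z. list_all2 (\<lambda>g y. evals g (list_decode (a z)) y) gs (list_decode (b z)))"
    if "computable_nat a" "computable_nat b" for a b
    using that by fastforce
  have "evals (Comp f gs) xs z \<longleftrightarrow>
      (\<exists>ys. list_all2 (\<lambda>g y. evals g xs y) gs ys \<and> evals f ys z)" for xs z
    by (auto elim: evals.cases intro: evals.intros)
  then have "evals (Comp f gs) xs z \<longleftrightarrow>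
      (\<exists>c. list_all2 (\<lambda>g y. evals g xs y) gs (list_decode c) \<and> evals f (list_decode c) z)" for xs z
    by (metis list_encode_inverse)
  then show ?case
    by (simp only:) (intro semidecidable_intros f gs computable_intros)
next
  case (PrimRec f g)
  have f: "semidecidable (\<lambda>z. evals f (list_decode (a z)) (b z))"
    if "computable_nat a" "computable_nat b" for a b
    using semidecidable_comp[OF PrimRec(1) computable_pair[OF that]] by simp
  have g: "semidecidable (\<lambda>z. evals g (list_decode (a z)) (b z))"
    if "computable_nat a" "computable_nat b" for a b
    using semidecidable_comp[OF PrimRec(2) computable_pair[OF that]] by simp
  \<comment> \<open>The history of the recursion becomes a base and a number, so that only
    quantifiers over numbers remain.\<close>
  have dig: "(\<exists>s. evals f xs (s 0) \<and> (\<forall>i<k. evals g (i # s i # xs) (s (Suc i))) \<and> y = s k)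
      \<longleftrightarrow> (\<exists>b e. evals f xs (dig b e 0) \<and> (\<forall>i<k. evals g (i # dig b e i # xs) (dig b e (Suc i)))
        \<and> y = dig b e k)" (is "?L \<longleftrightarrow> ?R") for xs k y
  proof
    assume ?L
    then obtain s where s: "evals f xs (s 0)" "\<forall>i<k. evals g (i # s i # xs) (s (Suc i))" "y = s k" by blast
    obtain b e where "\<forall>j<Suc k. dig b e j = s j" using ex_dig_base by blast
    with s show ?R by (intro exI[of _ b] exI[of _ e]) simp
  qed blast
  have "evals (PrimRec f g) xs y \<longleftrightarrow> (\<exists>k xs'. xs = k # xs' \<and> evals (PrimRec f g) (k # xs') y)" for xs y
    by (cases xs) (auto elim: evals.cases)
  then have "evals (PrimRec f g) (list_decode c) y \<longleftrightarrow>
      (\<exists>k c' b e. c = Suc (pair k c') \<and> evals f (list_decode c') (dig b e 0) \<and>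
        (\<forall>i<k. evals g (list_decode (Suc (pair i (Suc (pair (dig b e i) c'))))) (dig b e (Suc i))) \<and>
        y = dig b e k)" for c y
    unfolding evals_PrimRec_iff dig list_decode_Suc by (auto simp: list_decode_eq_Cons) 
  then show ?case
    by (simp only:) (intro semidecidable_intros f g semidecidable_decidable computable_intros computable_dig)
next
  case (Mu f)
  have f: "semidecidable (\<lambda>z. evals f (list_decode (a z)) (b z))"
    if "computable_nat a" "computable_nat b" for a b
    using semidecidable_comp[OF Mu computable_pair[OF that]] by simp
  have "evals (Mu f) xs k \<longleftrightarrow> evals f (k # xs) 0 \<and> (\<forall>i<k. \<exists>y>0. evals f (i # xs) y)" for xs k
    by (auto elim: evals.cases intro: evals.intros)
  then have "evals (Mu f) (list_decode c) k \<longleftrightarrow> evals f (list_decode (Suc (pair k c))) 0 \<and>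
      (\<forall>i<k. \<exists>y. 0 < y \<and> evals f (list_decode (Suc (pair i c))) y)" for c k
    by (simp only: list_decode_Suc)
  then show ?case
    by (simp only:) (intro semidecidable_intros f semidecidable_decidable computable_intros)
qed

subsection \<open>Dispersing tables\<close>

text \<open>Strings of lengths \<open>n\<close>, \<open>h\<close> and \<open>m\<close> are
  represented by numbers. The product form avoids the truncated exponent \<open>m - d\<close>: for
  \<open>d > m\<close> it forces the count to be 0.\<close>

definition disperses :: "nat \<Rightarrow> nat \<Rightarrow> nat \<Rightarrow> nat \<Rightarrow> nat \<Rightarrow> (nat \<Rightarrow> nat \<Rightarrow> nat) \<Rightarrow> bool" where
  "disperses n m h d r F \<longleftrightarrow> (\<forall>B\<subseteq>{..<2 ^ m}. card B < 2 ^ (m - r) \<longrightarrow>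
     card {i. i < 2 ^ n \<and> (\<forall>a<2 ^ h. F i a \<in> B)} * 2 ^ d \<le> 2 ^ m)"

lemma dispersesD:
  assumes "disperses n m h d r F" "B \<subseteq> {..<2 ^ m}" "card B < 2 ^ (m - r)"
  shows "card {i. i < 2 ^ n \<and> (\<forall>a<2 ^ h. F i a \<in> B)} * 2 ^ d \<le> 2 ^ m"
  using assms unfolding disperses_def by blast

text \<open>Only the empty set is small enough, and it traps nothing because at least one advice
  exists. Hence the search for a loss always succeeds.\<close>

lemma disperses_full: "disperses n m h d m F"
  unfolding disperses_def
proof (intro allI impI)
  fix B :: "nat set" assume B: "B \<subseteq> {..<2 ^ m}" "card B < 2 ^ (m - m)"
  then have "B = {}" using finite_subset[OF B(1)] by auto
  then have *: "{i::nat. i < 2 ^ n \<and> (\<forall>a<2 ^ h. F i a \<in> B)} = {}" by (auto intro!: exI[of _ 0])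
  show "card {i. i < 2 ^ n \<and> (\<forall>a<2 ^ h. F i a \<in> B)} * 2 ^ d \<le> 2 ^ m"
    unfolding * by simp
qed

text \<open>Every output occurs as the advice varies, so no proper subset of the outputs traps an
  input.\<close>

lemma disperses_advice:
  assumes "m \<le> h"
  shows "disperses n m h d 0 (\<lambda>i a. a mod 2 ^ m)"
  unfolding disperses_def
proof (intro allI impI)
  fix B :: "nat set" assume B: "B \<subseteq> {..<2 ^ m}" "card B < 2 ^ (m - 0)"
  then obtain y where y: "y < 2 ^ m" "y \<notin> B"
    using card_mono[OF finite_subset[OF B(1)], of "{..<2 ^ m}"] by fastforce
  moreover have "(2::nat) ^ m \<le> 2 ^ h" using assms by (simp add: power_increasing)
  ultimately have "\<not> (\<forall>a<2 ^ h. a mod 2 ^ m \<in> B)" by (metis mod_less order_less_le_trans)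
  then have *: "{i::nat. i < 2 ^ n \<and> (\<forall>a<2 ^ h. a mod 2 ^ m \<in> B)} = {}" by blast
  show "card {i::nat. i < 2 ^ n \<and> (\<forall>a<2 ^ h. a mod 2 ^ m \<in> B)} * 2 ^ d \<le> 2 ^ m"
    unfolding * by simp
qed

text \<open>Each output has at most \<open>2 ^ (n - m)\<close> preimages, so \<open>B\<close> traps
  at most \<open>card B * 2 ^ (n - m)\<close> inputs; the condition on \<open>r\<close> pays for
  this factor and for \<open>2 ^ d\<close>.\<close>

lemma disperses_prefix:
  assumes "m \<le> n" "n - m + d \<le> r" "r \<le> m"
  shows "disperses n m h d r (\<lambda>i a. i div 2 ^ (n - m))"
  unfolding disperses_def
proof (intro allI impI)
  fix B :: "nat set" assume B: "B \<subseteq> {..<2 ^ m}" "card B < 2 ^ (m - r)"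
  define T where "T = {i::nat. i < 2 ^ n \<and> (\<forall>a<(2::nat) ^ h. i div 2 ^ (n - m) \<in> B)}"
  have fin: "finite (B \<times> {..<2 ^ (n - m) :: nat})"
    using finite_subset[OF B(1)] by simp
  have "inj_on (\<lambda>i. (i div 2 ^ (n - m), i mod 2 ^ (n - m))) T"
    by (rule inj_onI) (metis div_mult_mod_eq prod.inject)
  moreover have "(0::nat) < 2 ^ h" by simp
  then have "i div 2 ^ (n - m) \<in> B" if "i \<in> T" for i
    using that unfolding T_def by blast
  then have "(\<lambda>i. (i div 2 ^ (n - m), i mod 2 ^ (n - m))) ` T \<subseteq> B \<times> {..<2 ^ (n - m)}"
    by auto
  ultimately have "card T \<le> card B * 2 ^ (n - m)"
    using card_inj_on_le[OF _ _ fin] by (simp add: card_cartesian_product)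
  also have "\<dots> \<le> 2 ^ (m - r) * 2 ^ (n - m)" using B(2) by simp
  finally have "card T * 2 ^ d \<le> 2 ^ (m - r + (n - m) + d)" by (simp add: power_add)
  also have "\<dots> \<le> 2 ^ m" using assms by (intro power_increasing) auto
  finally show "card {i. i < 2 ^ n \<and> (\<forall>a<(2::nat) ^ h. i div 2 ^ (n - m) \<in> B)} * 2 ^ d \<le> 2 ^ m"
    by (simp add: T_def)
qed

text \<open>A table is chosen cell by cell: rows in \<open>X\<close> offer \<open>card B\<close>
  values, all others \<open>card M\<close>. This is the size of one bad event in the union
  bound.\<close>

lemma card_PiE_restricted:
  fixes N H :: nat and M :: "'c set"
  assumes "X \<subseteq> {..<N}"
  shows "card (PiE ({..<N} \<times> {..<H}) (\<lambda>(i, a). if i \<in> X then B else M)) =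
    card B ^ (card X * H) * card M ^ ((N - card X) * H)"
proof -
  have fX: "finite X" using assms finite_subset by blast
  have "card (PiE ({..<N} \<times> {..<H}) (\<lambda>(i, a). if i \<in> X then B else M)) =
      (\<Prod>(i, a)\<in>{..<N} \<times> {..<H}. card (if i \<in> X then B else M))"
    by (simp add: card_PiE case_prod_unfold)
  also have "\<dots> = (\<Prod>i<N. (if i \<in> X then card B ^ H else card M ^ H))"
    by (subst prod.cartesian_product[symmetric]) (auto intro!: prod.cong)
  also have "\<dots> = (\<Prod>i\<in>X. card B ^ H) * (\<Prod>i\<in>{..<N} - X. card M ^ H)"
    using assms by (subst prod.If_cases) (auto simp: Int_absorb1 Diff_eq)
  finally show ?thesis
    using assms fX by (simp add: card_Diff_subset power_mult[symmetric] mult.commute)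
qed

text \<open>The probabilistic method by counting: the tables that confine some \<open>K\<close> rows
  to some \<open>L\<close> outputs are fewer than all tables, and any table outside their union
  disperses.\<close>

lemma disperses_random:
  assumes "d \<le> r" "r \<le> m" "m \<le> n" and large: "n + m < r * 2 ^ h"
  shows "\<exists>F. (\<forall>i<2 ^ n. \<forall>a<2 ^ h. F i a < 2 ^ m) \<and> disperses n m h d r F"
proof -
  define N :: nat where "N = 2 ^ n"
  define M :: nat where "M = 2 ^ m"
  define H :: nat where "H = 2 ^ h"
  define L :: nat where "L = 2 ^ (m - r)"
  define K :: nat where "K = 2 ^ (m - d)"
  have LK: "L \<le> K" "K \<le> N" "L \<le> M"
    unfolding L_def K_def N_def M_def using assms by (auto intro!: power_increasing)
  define bad :: "nat set \<times> nat set \<Rightarrow> (nat \<times> nat \<Rightarrow> nat) set" where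
    "bad = (\<lambda>(B, X). PiE ({..<N} \<times> {..<H}) (\<lambda>(i, a). if i \<in> X then B else {..<M}))"
  define I where "I = {B. B \<subseteq> {..<M} \<and> card B = L} \<times> {X. X \<subseteq> {..<N} \<and> card X = K}"
  have finI: "finite I" unfolding I_def by auto
  have "card (\<Union>z\<in>I. bad z) \<le> (\<Sum>z\<in>I. card (bad z))" by (rule card_UN_le[OF finI])
  also have "\<dots> = (\<Sum>z\<in>I. L ^ (K * H) * M ^ ((N - K) * H))"
    by (intro sum.cong) (auto simp: I_def bad_def card_PiE_restricted)
  also have "\<dots> = card I * (L ^ (K * H) * M ^ ((N - K) * H))" by simp
  also have "card I = (M choose L) * (N choose K)"
    unfolding I_def card_cartesian_product by (simp add: n_subsets)
  also have "\<dots> \<le> M ^ L * N ^ K"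
    using LK by (intro mult_le_mono binomial_le_pow) auto
  finally have "card (\<Union>z\<in>I. bad z) \<le> M ^ L * N ^ K * L ^ (K * H) * M ^ ((N - K) * H)"
    by (simp add: mult.assoc)
  also have "\<dots> < M ^ (K * H) * M ^ ((N - K) * H)"
  proof (rule mult_strict_right_mono)
    \<comment> \<open>Exponents of two are compared: choosing \<open>B\<close> and \<open>X\<close>
      contributes at most \<open>m * L + n * K\<close>, while confinement saves
      \<open>r * (K * H)\<close>. Here \<open>L \<le> K\<close> comes from
      \<open>d \<le> r\<close>.\<close>
    have "m * L + n * K \<le> (n + m) * K" using LK(1) by (simp add: algebra_simps)
    also have "\<dots> < r * H * K" using large by (simp add: K_def H_def)
    finally have "m * L + n * K + (m - r) * (K * H) < r * (K * H) + (m - r) * (K * H)"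
      by (simp add: ac_simps)
    also have "\<dots> = m * (K * H)" using assms(2) by (simp flip: distrib_right)
    finally have "(2::nat) ^ (m * L + n * K + (m - r) * (K * H)) < 2 ^ (m * (K * H))" by simp
    then show "M ^ L * N ^ K * L ^ (K * H) < M ^ (K * H)"
      unfolding M_def N_def L_def by (simp add: power_add power_mult[symmetric])
  qed (simp add: M_def)
  also have "\<dots> = M ^ (N * H)"
    using LK(2) by (simp flip: power_add distrib_right)
  also have "\<dots> = card ({..<N} \<times> {..<H} \<rightarrow>\<^sub>E {..<M})"
    by (simp add: card_funcsetE card_cartesian_product)
  finally obtain f where f: "f \<in> {..<N} \<times> {..<H} \<rightarrow>\<^sub>E {..<M}" "\<And>z. z \<in> I \<Longrightarrow> f \<notin> bad z"
    using card_mono[of "\<Union>z\<in>I. bad z" "{..<N} \<times> {..<H} \<rightarrow>\<^sub>E {..<M}"] finI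
    by (force simp: bad_def I_def not_less[symmetric] intro!: finite_PiE dest: finite_subset)
  have "disperses n m h d r (\<lambda>i a. f (i, a))"
    unfolding disperses_def
  proof (intro allI impI, rule ccontr)
    fix B :: "nat set" assume B: "B \<subseteq> {..<2 ^ m}" "card B < 2 ^ (m - r)"
    define T where "T = {i. i < 2 ^ n \<and> (\<forall>a<2 ^ h. f (i, a) \<in> B)}"
    assume "\<not> card {i. i < 2 ^ n \<and> (\<forall>a<2 ^ h. f (i, a) \<in> B)} * 2 ^ d \<le> 2 ^ m"
    moreover have "(2::nat) ^ m = K * 2 ^ d" using assms by (simp add: K_def flip: power_add)
    ultimately have "K \<le> card T" by (simp add: T_def)
    \<comment> \<open>The trapped inputs are cut down to exactly \<open>K\<close> and
      \<open>B\<close> is enlarged to exactly \<open>L\<close>, so that the pair belongs to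
      \<open>I\<close>.\<close>
    then obtain X where X: "X \<subseteq> T" "card X = K" by (meson obtain_subset_with_card_n)
    obtain B' where B': "B \<subseteq> B'" "B' \<subseteq> {..<M}" "card B' = L"
      using exists_subset_between[of B L "{..<M}"] B LK(3) by (auto simp: L_def M_def)
    have "(B', X) \<in> I" using B' X by (auto simp: I_def T_def N_def)
    moreover have "f \<in> bad (B', X)"
      using f(1) X(1) B'(1) by (fastforce simp: bad_def PiE_iff T_def H_def split: if_splits)
    ultimately show False using f(2) by blast
  qed
  moreover have "\<forall>i<2 ^ n. \<forall>a<2 ^ h. f (i, a) < 2 ^ m"
    using f(1) by (auto simp: PiE_iff N_def H_def M_def)
  ultimately show ?thesis by (intro exI[of _ "\<lambda>i a. f (i, a)"]) blast
qed

section \<open>Numerical codes of tables and the search for the best one\<close>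

definition table :: "nat \<Rightarrow> nat \<Rightarrow> nat \<Rightarrow> nat \<Rightarrow> nat \<Rightarrow> nat" where
  "table m h e i a = dig (2 ^ m) e (i * 2 ^ h + a)"

lemma table_less: "table m h e i a < 2 ^ m"
  by (simp add: table_def dig_def)

definition tables :: "nat \<Rightarrow> nat \<Rightarrow> nat \<Rightarrow> nat" where
  "tables n m h = (2 ^ m) ^ (2 ^ n * 2 ^ h)"

text \<open>The values of \<open>F\<close> are laid out row by row as digits. Dispersion looks only
  at arguments in range, where the coded table agrees with \<open>F\<close>.\<close>

lemma ex_table:
  assumes "\<forall>i<2 ^ n. \<forall>a<2 ^ h. F i a < 2 ^ m" "disperses n m h d r F"
  shows "\<exists>e<tables n m h. disperses n m h d r (table m h e)"
proof -
  have "F (j div 2 ^ h) (j mod 2 ^ h) < 2 ^ m" if "j < 2 ^ n * 2 ^ h" for j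
    using assms(1) that by (simp add: less_mult_imp_div_less)
  from ex_dig[of "2 ^ n * 2 ^ h" "\<lambda>j. F (j div 2 ^ h) (j mod 2 ^ h)", OF this]
  obtain e where e: "e < tables n m h"
    "\<And>j. j < 2 ^ n * 2 ^ h \<Longrightarrow> dig (2 ^ m) e j = F (j div 2 ^ h) (j mod 2 ^ h)"
    unfolding tables_def by blast
  have "table m h e i a = F i a" if "i < 2 ^ n" "a < 2 ^ h" for i a
  proof -
    have "i * 2 ^ h + a < Suc i * 2 ^ h" using that by simp
    also have "\<dots> \<le> 2 ^ n * 2 ^ h" using that by (intro mult_le_mono1) simp
    finally show ?thesis using e(2)[of "i * 2 ^ h + a"] that by (simp add: table_def)
  qed
  then have "{i. i < 2 ^ n \<and> (\<forall>a<2 ^ h. table m h e i a \<in> B)} =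
      {i. i < 2 ^ n \<and> (\<forall>a<2 ^ h. F i a \<in> B)}" for B
    by auto
  with assms(2) e(1) show ?thesis unfolding disperses_def by auto
qed

text \<open>Subsets of \<open>{..<2 ^ m}\<close> are encoded by binary digits, so that the quantifier becomes bounded.\<close>

lemma disperses_iff_digits:
  assumes "\<And>i a. F i a < 2 ^ m"
  shows "disperses n m h d r F \<longleftrightarrow> (\<forall>b<2 ^ (2 ^ m). card {y. y < 2 ^ m \<and> dig 2 b y = 1} < 2 ^ (m - r) \<longrightarrow>
     card {i. i < 2 ^ n \<and> (\<forall>a<2 ^ h. dig 2 b (F i a) = 1)} * 2 ^ d \<le> 2 ^ m)"
proof -
  have "(\<forall>B\<subseteq>{..<2 ^ m}. P B) \<longleftrightarrow> (\<forall>b<2 ^ (2 ^ m). P {y. y < 2 ^ m \<and> dig 2 b y = 1})"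
    for P :: "nat set \<Rightarrow> bool"
  proof (intro iffI allI impI)
    fix B :: "nat set" assume *: "\<forall>b<2 ^ (2 ^ m). P {y. y < 2 ^ m \<and> dig 2 b y = 1}" and B: "B \<subseteq> {..<2 ^ m}"
    obtain b where b: "b < 2 ^ (2 ^ m)" "\<And>y. y < 2 ^ m \<Longrightarrow> dig 2 b y = (if y \<in> B then 1 else 0)"
      using ex_dig[of "2 ^ m" "\<lambda>y. if y \<in> B then 1 else 0" 2] by fastforce
    have "{y. y < 2 ^ m \<and> dig 2 b y = 1} = B" using b(2) B by (auto split: if_splits)
    with * b(1) show "P B" by metis
  qed (simp add: subset_eq)
  then show ?thesis unfolding disperses_def using assms by simp
qed

lemma computable_table:
  assumes "computable_nat m" "computable_nat h" "computable_nat e" "computable_nat i" "computable_nat a"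
  shows "computable_nat (\<lambda>z. table (m z) (h z) (e z) (i z) (a z))"
  unfolding table_def by (intro computable_dig computable_intros assms)

lemma decidable_disperses:
  assumes "computable_nat n" "computable_nat m" "computable_nat h" "computable_nat d"
    "computable_nat r" "computable_nat e"
  shows "decidable (\<lambda>z. disperses (n z) (m z) (h z) (d z) (r z) (table (m z) (h z) (e z)))"
  unfolding disperses_iff_digits[OF table_less]
  by (intro computable_table computable_dig computable_intros assms assms[THEN computable_comp])

text \<open>The bound on \<open>e\<close> keeps the condition on \<open>r\<close> decidable, so the
  minimum is computable. With \<open>r\<close> fixed, \<open>best_table\<close> may search without a
  bound, since a witness exists.\<close>

definition loss :: "nat \<Rightarrow> nat \<Rightarrow> nat \<Rightarrow> nat \<Rightarrow> nat" where
  "loss n m h d = (LEAST r. \<exists>e<tables n m h. disperses n m h d r (table m h e))"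

definition best_table :: "nat \<Rightarrow> nat \<Rightarrow> nat \<Rightarrow> nat \<Rightarrow> nat" where
  "best_table n m h d = (LEAST e. disperses n m h d (loss n m h d) (table m h e))"

lemma ex_loss: "\<exists>r. \<exists>e<tables n m h. disperses n m h d r (table m h e)"
  by (intro exI[of _ m] exI[of _ 0]) (simp add: disperses_full tables_def)

lemma ex_best_table: "\<exists>e. disperses n m h d (loss n m h d) (table m h e)"
  using LeastI_ex[OF ex_loss[of n m h d]] unfolding loss_def by blast

lemma disperses_best_table: "disperses n m h d (loss n m h d) (table m h (best_table n m h d))"
  unfolding best_table_def by (rule LeastI_ex[OF ex_best_table])

lemma loss_le:
  assumes "\<forall>i<2 ^ n. \<forall>a<2 ^ h. F i a < 2 ^ m" "disperses n m h d r F"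
  shows "loss n m h d \<le> r"
  unfolding loss_def by (rule Least_le) (rule ex_table[OF assms])

lemma loss_le_full: "loss n m h d \<le> m"
  by (rule loss_le[of n h "\<lambda>i a. 0"]) (simp_all add: disperses_full)

lemma loss_advice: "m \<le> h \<Longrightarrow> loss n m h d = 0"
  using loss_le[OF _ disperses_advice] by fastforce

lemma loss_le_prefix:
  assumes "m \<le> n" shows "loss n m h d \<le> n - m + d"
proof (cases "n - m + d \<le> m")
  case True
  have "i div 2 ^ (n - m) < 2 ^ m" if "i < 2 ^ n" for i :: nat
    using that assms by (intro less_mult_imp_div_less) (simp flip: power_add)
  with True assms show ?thesis by (intro loss_le[OF _ disperses_prefix]) auto
next
  case False
  then show ?thesis using loss_le_full[of n m h d] by linarith
qed

lemma loss_le_random: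
  assumes "d \<le> r" "r \<le> m" "m \<le> n" "n + m < r * 2 ^ h"
  shows "loss n m h d \<le> r"
  using disperses_random[OF assms] loss_le by blast

lemma computable_loss:
  assumes "computable_nat n" "computable_nat m" "computable_nat h" "computable_nat d"
  shows "computable_nat (\<lambda>z. loss (n z) (m z) (h z) (d z))"
  unfolding loss_def tables_def
  by (intro computable_Least ex_loss[unfolded tables_def] decidable_disperses computable_intros
      assms assms[THEN computable_comp])

lemma computable_best_table:
  assumes "computable_nat n" "computable_nat m" "computable_nat h" "computable_nat d"
  shows "computable_nat (\<lambda>z. best_table (n z) (m z) (h z) (d z))"
  unfolding best_table_def
  by (intro computable_Least ex_best_table decidable_disperses computable_loss computable_intros
      assms assms[THEN computable_comp])

section \<open>Asymptotic bound on the loss\<close>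

text \<open>For small \<open>m\<close> the growth of \<open>h\<close> eventually forces
  \<open>m \<le> h\<close>, where the loss is 0. For large \<open>m\<close> with
  \<open>h < m\<close>, truncation serves if \<open>n \<le> (1 + e / 2) * m\<close>, and a random
  function otherwise.\<close>

lemma loss_smallo:
  fixes m h :: "nat \<Rightarrow> nat"
  assumes m: "\<forall>n\<ge>1. m n < n"
    and h: "(\<lambda>n. real (h n)) \<in> \<omega>(\<lambda>n. log 2 (real n / real (m n)))"
  shows "(\<lambda>n. real (loss n (m n) (h n) d)) \<in> o(\<lambda>n. real (m n))"
proof (rule landau_o.smallI)
  fix c :: real assume "c > 0"
  \<comment> \<open>The cap at 1 ensures that the later choice of \<open>r\<close> is at most
    \<open>m n\<close>.\<close>
  define e where "e = min c 1"
  have e: "0 < e" "e \<le> 1" "e \<le> c" using \<open>c > 0\<close> by (auto simp: e_def)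
  \<comment> \<open>Chosen so that \<open>C * l \<ge> log 2 (4 / e) + l\<close> whenever
    \<open>l \<ge> log 2 (1 + e / 2)\<close>.\<close>
  define C where "C = 1 + log 2 (4 / e) / log 2 (1 + e / 2)"
  have log_e: "log 2 (4 / e) \<ge> 0" "log 2 (1 + e / 2) > 0"
    using e by (auto simp: field_simps)
  then have "C \<ge> 1" by (simp add: C_def)
  \<comment> \<open>Beyond \<open>M0\<close>, half of \<open>e * m n\<close> absorbs both
    \<open>d\<close> and a rounding error of 1.\<close>
  obtain M0 :: nat where "real M0 \<ge> (2 * real d + 2) / e" using real_arch_simple by blast
  then have M0: "e * real M0 \<ge> 2 * real d + 2" using e by (simp add: field_simps)
  have "\<forall>\<^sub>F n in at_top. norm (real (h n)) \<ge> C * norm (log 2 (real n / real (m n)))"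
    using landau_omega.smallD[OF h, of C] \<open>C \<ge> 1\<close> by simp
  then show "\<forall>\<^sub>F n in at_top. norm (real (loss n (m n) (h n) d)) \<le> c * norm (real (m n))"
    using eventually_ge_at_top[of "Suc (M0 * 2 ^ M0)"]
  proof eventually_elim
    case (elim n)
    define l where "l = log 2 (real n / real (m n))"
    have mn: "m n < n" using m elim(2) by auto
    consider "m n \<le> h n" | "h n < m n" "m n \<le> M0" | "h n < m n" "M0 < m n" by linarith
    then have "real (loss n (m n) (h n) d) \<le> e * real (m n)"
    proof cases
      case 1
      then show ?thesis using e by (simp add: loss_advice)
    next
      case 2
      then have pos: "m n > 0" by simp
      \<comment> \<open>This case is contradictory: \<open>n / m n\<close> is at least
        \<open>2 ^ M0\<close>, which forces \<open>h n \<ge> M0 \<ge> m n\<close>.\<close>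
      have "2 ^ M0 * m n \<le> M0 * 2 ^ M0" using 2 by simp
      also have "\<dots> \<le> n" using elim(2) by simp
      finally have "real (2 ^ M0 * m n) \<le> real n" by (simp only: of_nat_le_iff)
      then have "2 powr real M0 \<le> real n / real (m n)" using pos by (simp add: field_simps powr_realpow)
      then have "real M0 \<le> l" unfolding l_def using pos mn by (subst le_log_iff) auto
      also have "l \<le> C * norm l" using mult_right_mono[OF \<open>C \<ge> 1\<close>, of "norm l"] by simp
      also have "\<dots> \<le> real (h n)" using elim(1) by (simp add: l_def)
      finally show ?thesis using 2 by simp
    next
      case 3
      then have pos: "m n > 0" by simp
      have "e * real M0 \<le> e * real (m n)" using 3 e by simp
      then have em: "e * real (m n) \<ge> 2 * real d + 2" using M0 by linarith
      show ?thesis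
      proof (cases "real n - real (m n) \<le> e / 2 * real (m n)")
        case True
        have "real (loss n (m n) (h n) d) \<le> real (n - m n + d)"
          using loss_le_prefix[of "m n" n "h n" d] mn by (simp del: of_nat_add)
        also have "\<dots> = real n - real (m n) + real d" using mn by simp
        finally show ?thesis using True em by linarith
      next
        case False
        \<comment> \<open>Rounding down costs less than 1, so \<open>r\<close> stays above both
          \<open>d\<close> and \<open>e / 2 * m n\<close>.\<close>
        define r where "r = nat \<lfloor>e * real (m n)\<rfloor>"
        have r: "real r \<le> e * real (m n)" "real r > e * real (m n) - 1"
          using em unfolding r_def by auto
        have "e * real (m n) \<le> real (m n)" using e mult_right_mono[of e 1 "real (m n)"] by simp
        then have "r \<le> m n" using r by linarith
        moreover have "d \<le> r" using r em by linarith
        moreover have "n + m n < r * 2 ^ h n"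
        proof -
          have "1 + e / 2 \<le> real n / real (m n)" using False pos by (simp add: field_simps)
          then have l: "log 2 (1 + e / 2) \<le> l" unfolding l_def using e by (intro log_mono) auto
          have "log 2 (4 / e) + l \<le> C * l"
            using mult_left_mono[OF l, of "log 2 (4 / e) / log 2 (1 + e / 2)"] log_e
            by (simp add: C_def algebra_simps)
          also have "\<dots> \<le> real (h n)" using elim(1) l log_e by (simp add: l_def)
          \<comment> \<open>Multiplying this lower bound on \<open>2 ^ h n\<close> by
            \<open>r \<ge> e / 2 * m n\<close> gives at least \<open>2 * n\<close>, which exceeds
            \<open>n + m n\<close>.\<close>
          finally have "4 / e * (real n / real (m n)) \<le> 2 powr real (h n)"
            unfolding l_def using e mn pos
            by (subst (asm) log_mult_pos[symmetric]) (auto simp: log_le_iff)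
          then have "2 * real n \<le> e / 2 * real (m n) * 2 ^ h n"
            using e pos by (simp add: field_simps powr_realpow)
          also have "\<dots> \<le> real r * 2 ^ h n" using r em by (intro mult_right_mono) simp_all
          finally have "real (2 * n) \<le> real (r * 2 ^ h n)" by simp
          then have "2 * n \<le> r * 2 ^ h n" by (simp only: of_nat_le_iff)
          then show ?thesis using mn by linarith
        qed
        ultimately have "loss n (m n) (h n) d \<le> r" using mn by (intro loss_le_random) auto
        then show ?thesis using r by linarith
      qed
    qed
    also have "\<dots> \<le> c * real (m n)" using e by (intro mult_right_mono) auto
    finally show ?case by simp
  qed
qed

subsection \<open>Strings, machines and enumerations\<close>

lemma code_str_of_nat [simp]: "code (str_of_nat n) = n"
  unfolding str_of_nat_def by (rule surj_f_inv_f[OF surj_code])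

lemma str_of_nat_code [simp]: "str_of_nat (code s) = s"
  unfolding str_of_nat_def by (rule inv_f_f[OF inj_code])

text \<open>In bijective base two the strings of length \<open>k\<close> have exactly the codes
  \<open>2 ^ k - 1 + i\<close> with \<open>i < 2 ^ k\<close>. This offset translates between strings
  of fixed length and numbers throughout.\<close>

lemma code_bounds: "2 ^ length s \<le> Suc (code s) \<and> Suc (code s) < 2 ^ Suc (length s)"
  by (induction s) auto

lemma length_eq_iff: "length s = k \<longleftrightarrow> 2 ^ k \<le> Suc (code s) \<and> Suc (code s) < 2 ^ Suc k"
proof
  assume *: "2 ^ k \<le> Suc (code s) \<and> Suc (code s) < 2 ^ Suc k"
  then have "(2::nat) ^ k < 2 ^ Suc (length s)" "(2::nat) ^ length s < 2 ^ Suc k"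
    using code_bounds[of s] by (auto intro: le_less_trans)
  then have "k < Suc (length s)" "length s < Suc k"
    by (auto dest: power_less_imp_less_exp[rotated] simp del: power_Suc)
  then show "length s = k" by simp
qed (use code_bounds in auto)

lemma length_str_of_nat:
  "i < 2 ^ k \<Longrightarrow> length (str_of_nat (2 ^ k - 1 + i)) = k"
  unfolding length_eq_iff by simp

lemma length_less_iff: "length s < k \<longleftrightarrow> code s < 2 ^ k - 1"
proof
  assume "length s < k"
  then have "(2::nat) ^ Suc (length s) \<le> 2 ^ k" by (intro power_increasing) auto
  then show "code s < 2 ^ k - 1" using code_bounds[of s] by linarith
next
  assume "code s < 2 ^ k - 1"
  then have "(2::nat) ^ length s < 2 ^ k" using code_bounds[of s] by linarith
  then show "length s < k" by simp
qed

definition len :: "nat \<Rightarrow> nat" where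
  "len c = (LEAST k. Suc c < 2 ^ Suc k)"

lemma len_code: "len (code s) = length s"
  unfolding len_def
proof (rule Least_equality)
  fix k assume "Suc (code s) < 2 ^ Suc k"
  with code_bounds[of s] have "(2::nat) ^ length s < 2 ^ Suc k" by linarith
  then have "length s < Suc k" by (rule power_less_imp_less_exp[rotated]) simp
  then show "length s \<le> k" by simp
qed (use code_bounds in blast)

lemma computable_len: "computable_nat len"
  unfolding len_def
proof (rule computable_Least)
  show "\<exists>k. Suc z < 2 ^ Suc k" for z
    using less_exp[of "Suc z"] by (intro exI[of _ z])
qed (intro computable_intros)

text \<open>The term is a \<open>Mu\<close> search followed by \<open>g\<close>. It halts only if a
  witness exists, which settles the converse direction of \<open>partial_computable\<close>.\<close>

lemma partial_computable_search:
  assumes Q: "decidable (\<lambda>w. Q (pfst w) (pfst (psnd w)) (psnd (psnd w)))"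
    and g: "computable_nat (\<lambda>w. g (pfst w) (pfst (psnd w)) (psnd (psnd w)))"
  shows "partial_computable (\<lambda>p v. if \<exists>w. Q w (code p) (code v)
    then Some (str_of_nat (g (LEAST w. Q w (code p) (code v)) (code p) (code v))) else None)"
    (is "partial_computable ?M")
proof -
  obtain F where F: "\<And>w p v. evals F [w, p, v] (if \<not> Q w p v then 1 else 0)"
    using computable3[of "\<lambda>w p v. if \<not> Q w p v then 1 else 0"] decidable_not[OF Q]
    unfolding decidable_def by blast
  obtain G where G: "\<And>w p v. evals G [w, p, v] (g w p v)"
    using computable3[OF g] by blast
  define f where "f = Comp G [Mu F, Proj 0, Proj 1]"
  have halts: "evals f [p, v] (g (LEAST w. Q w p v) p v)" if "\<exists>w. Q w p v" for p v
  proof -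
    have "evals F [LEAST w. Q w p v, p, v] 0"
      using F[of "LEAST w. Q w p v" p v] LeastI_ex[OF that] by simp
    moreover have "\<exists>y>0. evals F [i, p, v] y" if "i < (LEAST w. Q w p v)" for i
      using F[of i p v] not_less_Least[OF that] by (intro exI[of _ 1]) simp
    ultimately have "evals (Mu F) [p, v] (LEAST w. Q w p v)" by (intro evals.mu) auto
    then show ?thesis unfolding f_def by (rule evals_comp3[OF _ _ _ G]) (auto intro: evals_Proj)
  qed
  have diverges: "\<exists>w. Q w p v" if "evals f [p, v] y" for p v y
  proof -
    from that obtain k where "evals (Mu F) [p, v] k"
      unfolding f_def by (auto elim!: evals.cases[of "Comp _ _"] simp: list_all2_Cons1)
    then have "evals F [k, p, v] 0" by (auto elim: evals.cases)
    with F[of k p v] show ?thesis by (auto dest: evals_det split: if_splits)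
  qed
  show ?thesis
    unfolding partial_computable_def
  proof (intro exI[of _ f] allI iffI)
    fix p v u assume *: "?M p v = Some u"
    then have "\<exists>w. Q w (code p) (code v)"
      by (metis option.distinct(1))
    moreover from this and * have "u = str_of_nat (g (LEAST w. Q w (code p) (code v)) (code p) (code v))"
      by (metis option.inject)
    ultimately show "evals f [code p, code v] (code u)"
      using halts[of "code p" "code v"] by simp
  next
    fix p v u assume ev: "evals f [code p, code v] (code u)"
    from diverges[OF this] have ex: "\<exists>w. Q w (code p) (code v)" .
    with evals_det[OF ev halts[OF ex]] show "?M p v = Some u"
      by (metis str_of_nat_code)
  qed
qed

text \<open>
  Stage \<open>w\<close> of an enumeration of \<open>{i. i < N \<and> (\<exists>s. D s i)}\<close> tests whether \<open>D (w div N)\<close> admits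
  \<open>w mod N\<close>, and it is fresh if the test succeeds for this element for the first time.
\<close>

definition fresh :: "nat \<Rightarrow> (nat \<Rightarrow> nat \<Rightarrow> bool) \<Rightarrow> nat \<Rightarrow> bool" where
  "fresh N D w \<longleftrightarrow> D (w div N) (w mod N) \<and>
     (\<forall>v<w. v mod N = w mod N \<longrightarrow> \<not> D (v div N) (v mod N))"

text \<open>Fresh stages are numbered from 0 in increasing order, so that \<open>j\<close> names the
  element \<open>w mod N\<close>.\<close>

definition enumerated :: "nat \<Rightarrow> (nat \<Rightarrow> nat \<Rightarrow> bool) \<Rightarrow> nat \<Rightarrow> nat \<Rightarrow> bool" where
  "enumerated N D j w \<longleftrightarrow> fresh N D w \<and> card {v. v < w \<and> fresh N D v} = j"

lemma enumerated_inj: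
  assumes "enumerated N D j v" "enumerated N D j w" shows "v = w"
proof -
  have False if "enumerated N D j v" "enumerated N D j w" "v < w" for v w
  proof -
    have "{u. u < v \<and> fresh N D u} \<subset> {u. u < w \<and> fresh N D u}"
      using that by (auto simp: enumerated_def)
    from psubset_card_mono[OF _ this] that show False by (simp add: enumerated_def)
  qed
  with assms show ?thesis by (metis linorder_neqE_nat)
qed

text \<open>The first stage that admits \<open>i\<close> is fresh. Distinct fresh stages have
  distinct residues, all in the enumerated set, so fewer stages than its cardinality precede this
  one.\<close>

lemma enumerated_ex:
  assumes "i < N" "\<exists>s. D s i"
  shows "\<exists>j w. j < card {i. i < N \<and> (\<exists>s. D s i)} \<and> enumerated N D j w \<and> w mod N = i"
proof -
  define S where "S = {i. i < N \<and> (\<exists>s. D s i)}"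
  define w where "w = (LEAST w. w mod N = i \<and> D (w div N) i)"
  obtain s where s: "D s i" using assms(2) by blast
  have ex: "\<exists>w. w mod N = i \<and> D (w div N) i"
    using s assms(1) by (intro exI[of _ "i + s * N"]) simp
  have w: "w mod N = i" "D (w div N) i" using LeastI_ex[OF ex] by (simp_all add: w_def)
  have "fresh N D w"
    unfolding fresh_def using w not_less_Least[of _ "\<lambda>w. w mod N = i \<and> D (w div N) i"]
    by (auto simp: w_def[symmetric])
  define P where "P = {v. v < w \<and> fresh N D v}"
  have "inj_on (\<lambda>v. v mod N) (insert w P)"
  proof (rule inj_onI)
    fix u v assume "u \<in> insert w P" "v \<in> insert w P" and eq: "u mod N = v mod N"
    then have "fresh N D u" "fresh N D v" using \<open>fresh N D w\<close> by (auto simp: P_def)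
    with eq show "u = v" unfolding fresh_def by (metis linorder_neqE_nat)
  qed
  moreover have "(\<lambda>v. v mod N) ` insert w P \<subseteq> S"
    using \<open>fresh N D w\<close> assms(1) by (auto simp: S_def P_def fresh_def)
  moreover have "finite S" by (simp add: S_def)
  ultimately have "card (insert w P) \<le> card S" by (rule card_inj_on_le)
  then have "card P < card S" by (simp add: P_def)
  with w(1) \<open>fresh N D w\<close> show ?thesis
    by (intro exI[of _ "card P"] exI[of _ w]) (simp add: enumerated_def P_def S_def)
qed

lemma decidable_enumerated:
  assumes D: "decidable (\<lambda>w. D (pfst w) (pfst (psnd w)) (psnd (psnd w)))"
    and "computable_nat N" "computable_nat j" "computable_nat w"
  shows "decidable (\<lambda>z. enumerated (N z) (\<lambda>s i. D s i z) (j z) (w z))"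
proof -
  have D': "decidable (\<lambda>z. D (a z) (b z) (c z))"
    if "computable_nat a" "computable_nat b" "computable_nat c" for a b c
    using decidable_comp[OF D computable_pair[OF that(1) computable_pair[OF that(2,3)]]] by simp
  show ?thesis unfolding enumerated_def fresh_def
    by (intro D' computable_intros assms(2-) assms(2-)[THEN computable_comp])
qed

lemma evals2_stages:
  obtains V where
    "\<And>t a b y. computable_nat t \<Longrightarrow> computable_nat a \<Longrightarrow> computable_nat b \<Longrightarrow> computable_nat y \<Longrightarrow>
      decidable (\<lambda>z. V (t z) (a z) (b z) (y z))"
    "\<And>a b y. evals f [a, b] y \<longleftrightarrow> (\<exists>t. V t a b y)"
proof -
  from semidecidable_evals[of f] obtain D where
    D: "\<And>a b. computable_nat a \<Longrightarrow> computable_nat b \<Longrightarrow> decidable (\<lambda>z. D (a z) (b z))"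
      "\<And>z. evals f (list_decode (pfst z)) (psnd z) \<longleftrightarrow> (\<exists>t. D t z)"
    by (rule semidecidableE) blast
  show thesis
  proof (rule that[of "\<lambda>t a b y. D t (pair (Suc (pair a (Suc (pair b 0)))) y)"])
    show "evals f [a, b] y \<longleftrightarrow> (\<exists>t. D t (pair (Suc (pair a (Suc (pair b 0)))) y))" for a b y
      unfolding D(2)[symmetric] by (simp add: list_decode_Suc del: list_decode.simps(2))
  qed (intro D(1) computable_intros)
qed

section \<open>Counting strings of small complexity\<close>

text \<open>Universality provides at least one program, so the \<open>LEAST\<close> in
  \<open>kolmogorov\<close> is attained.\<close>

lemma kolmogorov_less_iff:
  assumes "universal_machine U"
  shows "kolmogorov U u v < k \<longleftrightarrow> (\<exists>p. length p < k \<and> U p v = Some u)"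
proof
  obtain p where "U p v = Some u" using universal_machine_has_program[OF assms] by blast
  then have "\<exists>p. length p = kolmogorov U u v \<and> U p v = Some u"
    unfolding kolmogorov_def by (intro LeastI_ex[of "\<lambda>k. \<exists>p. length p = k \<and> U p v = Some u"]) blast
  then show "\<exists>p. length p < k \<and> U p v = Some u" if "kolmogorov U u v < k"
    using that by metis
next
  assume "\<exists>p. length p < k \<and> U p v = Some u"
  then show "kolmogorov U u v < k"
    unfolding kolmogorov_def by (metis (mono_tags, lifting) Least_le order_le_less_trans)
qed

text \<open>Different strings need different programs, and only \<open>2 ^ k - 1\<close> programs
  are shorter than \<open>k\<close>.\<close>

lemma card_simple_less:
  assumes "universal_machine U" "inj g"
  shows "card {y \<in> Y. kolmogorov U (g y) v < k} < 2 ^ k"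
proof -
  define B where "B = {y \<in> Y. kolmogorov U (g y) v < k}"
  have "\<forall>y\<in>B. \<exists>p. length p < k \<and> U p v = Some (g y)"
    by (simp add: B_def kolmogorov_less_iff[OF assms(1)])
  then obtain p where p: "\<And>y. y \<in> B \<Longrightarrow> length (p y) < k \<and> U (p y) v = Some (g y)" by metis
  have "inj_on (\<lambda>y. code (p y)) B"
  proof (rule inj_onI)
    fix y z assume "y \<in> B" "z \<in> B" "code (p y) = code (p z)"
    then have "g y = g z" using p by (metis injD[OF inj_code] option.inject)
    then show "y = z" by (rule injD[OF assms(2)])
  qed
  moreover have "(\<lambda>y. code (p y)) ` B \<subseteq> {..<2 ^ k - 1}"
    using p by (auto simp: length_less_iff)
  ultimately have "card B \<le> card {..<(2 ^ k - 1 :: nat)}"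
    by (rule card_inj_on_le) simp
  then have "card B \<le> 2 ^ k - 1" by simp
  moreover have "(0::nat) < 2 ^ k" by simp
  ultimately show ?thesis unfolding B_def by linarith
qed

section \<open>Construction of the ensemble and the compression argument\<close>

theorem theorem7:
  fixes U :: machine and m h :: "nat \<Rightarrow> nat"
  assumes "universal_machine U"
    and "computable_nat m"
    and "computable_nat h"
    and "\<forall>n\<ge>1. m n < n"
    and "(\<lambda>n. real (h n)) \<in> \<omega>(\<lambda>n. log 2 (real n / real (m n)))"
  shows "\<exists>E. computable_ensemble E \<and>
    (\<forall>n\<ge>1. \<forall>x \<alpha>. length x = n \<longrightarrow> length \<alpha> = h n \<longrightarrow> length (E n x \<alpha>) = m n) \<and>
    (\<exists>r \<in> o(\<lambda>n. real (m n)).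
      \<forall>n\<ge>1. \<forall>x. length x = n \<longrightarrow> kolmogorov U x (str_of_nat n) \<ge> m n \<longrightarrow>
        (\<exists>\<alpha>. length \<alpha> = h n \<and>
          real (kolmogorov U (E n x \<alpha>) (str_of_nat (m n))) \<ge> real (m n) - r n))"
proof -
  obtain f where f: "\<And>p v u. U p v = Some u \<longleftrightarrow> evals f [code p, code v] (code u)"
    using assms(1) unfolding universal_machine_def partial_computable_def by blast
  obtain V where dec_V:
    "\<And>t a b y. computable_nat t \<Longrightarrow> computable_nat a \<Longrightarrow> computable_nat b \<Longrightarrow> computable_nat y \<Longrightarrow>
      decidable (\<lambda>z. V (t z) (a z) (b z) (y z))"
    and V: "\<And>a b y. evals f [a, b] y \<longleftrightarrow> (\<exists>t. V t a b y)"
    using evals2_stages[of f] by blast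
  define lo where "lo d n = loss n (m n) (h n) d" for d n
  define F where "F d n = table (m n) (h n) (best_table n (m n) (h n) d)" for d n
  \<comment> \<open>A decidable stage of the event that input \<open>i\<close> is trapped. The
    numbers \<open>q\<close> run over the codes of programs shorter than
    \<open>m n - lo d n\<close>, and \<open>m n\<close> is itself the code of the condition.\<close>
  define adm where "adm d n s i \<longleftrightarrow> (\<forall>a<2 ^ h n. \<exists>q<2 ^ (m n - lo d n) - 1. \<exists>t<s.
    V t q (m n) (2 ^ m n - 1 + F d n i a))" for d n s i
  define simple where "simple d n = {y \<in> {..<2 ^ m n}.
    kolmogorov U (str_of_nat (2 ^ m n - 1 + y)) (str_of_nat (m n)) < m n - lo d n}" for d n
  have comp_F: "computable_nat (\<lambda>z. F (d z) (n z) (i z) (a z))"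
    if "computable_nat d" "computable_nat n" "computable_nat i" "computable_nat a" for d n i a
    unfolding F_def
    by (intro computable_table computable_best_table computable_comp[OF assms(2)]
        computable_comp[OF assms(3)] that)
  have dec_adm: "decidable (\<lambda>z. adm (d z) (n z) (s z) (i z))"
    if "computable_nat d" "computable_nat n" "computable_nat s" "computable_nat i" for d n s i
    unfolding adm_def lo_def
    by (intro dec_V comp_F computable_loss computable_intros computable_comp[OF assms(2)]
        computable_comp[OF assms(3)] that that[THEN computable_comp])
  have adm_iff: "(\<exists>s. adm d n s i) \<longleftrightarrow> (\<forall>a<2 ^ h n. F d n i a \<in> simple d n)" for d n i
  proof -
    define P where "P a t \<longleftrightarrow> (\<exists>q<2 ^ (m n - lo d n) - 1. V t q (m n) (2 ^ m n - 1 + F d n i a))" for a t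
    have "F d n i a \<in> simple d n \<longleftrightarrow> (\<exists>t. P a t)" for a
    proof -
      have "F d n i a \<in> simple d n \<longleftrightarrow> (\<exists>p. length p < m n - lo d n \<and>
          U p (str_of_nat (m n)) = Some (str_of_nat (2 ^ m n - 1 + F d n i a)))"
        by (simp add: simple_def F_def table_less kolmogorov_less_iff[OF assms(1)])
      also have "\<dots> \<longleftrightarrow> (\<exists>q<2 ^ (m n - lo d n) - 1. evals f [q, m n] (2 ^ m n - 1 + F d n i a))"
        unfolding f length_less_iff code_str_of_nat by (metis code_str_of_nat)
      finally show ?thesis unfolding V P_def by blast
    qed
    moreover have "(\<exists>s. \<forall>a<2 ^ h n. \<exists>t<s. P a t) \<longleftrightarrow> (\<forall>a<2 ^ h n. \<exists>t. P a t)"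
    proof
      assume "\<forall>a<2 ^ h n. \<exists>t. P a t"
      then obtain t where "\<And>a. a < 2 ^ h n \<Longrightarrow> P a (t a)" by metis
      moreover have "t a < Suc (\<Sum>a<2 ^ h n. t a)" if "a < 2 ^ h n" for a
        using that by (simp add: less_Suc_eq_le member_le_sum)
      ultimately show "\<exists>s. \<forall>a<2 ^ h n. \<exists>t<s. P a t" by blast
    qed blast
    moreover have "adm d n s i \<longleftrightarrow> (\<forall>a<2 ^ h n. \<exists>t<s. P a t)" for s
      unfolding adm_def P_def by blast
    ultimately show ?thesis by simp
  qed
  \<comment> \<open>A program carries two data: its length yields \<open>d\<close> as
    \<open>m n - len p\<close>, and its rank among strings of that length is the index. One machine
    thus serves all \<open>d\<close>, and its constant \<open>c\<close> is available before
    \<open>d\<close> is chosen.\<close>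
  define Q where "Q w p n \<longleftrightarrow>
    enumerated (2 ^ n) (adm (m n - len p) n) (Suc p - 2 ^ len p) w" for w p n
  define M :: machine where "M = (\<lambda>p v. if \<exists>w. Q w (code p) (code v)
    then Some (str_of_nat (2 ^ code v - 1 + (LEAST w. Q w (code p) (code v)) mod 2 ^ code v)) else None)"
  have "partial_computable M"
    unfolding M_def
  proof (rule partial_computable_search[where g = "\<lambda>w p n. 2 ^ n - 1 + w mod 2 ^ n"])
    show "decidable (\<lambda>w. Q (pfst w) (pfst (psnd w)) (psnd (psnd w)))"
      unfolding Q_def
      by (intro decidable_enumerated dec_adm computable_intros computable_comp[OF assms(2)]
          computable_comp[OF computable_len])
  qed (intro computable_intros)
  then obtain c where c: "\<And>p v u. M p v = Some u \<Longrightarrow> \<exists>q. length q \<le> length p + c \<and> U q v = Some u"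
    using assms(1) unfolding universal_machine_def by blast
  \<comment> \<open>A program of length \<open>m n - d\<close> becomes one of length at most
    \<open>m n - d + c\<close> for \<open>U\<close>, which has to be below
    \<open>m n\<close>.\<close>
  define d where "d = Suc c"
  \<comment> \<open>On strings of unexpected length some other table entry is read; entries always
    lie below \<open>2 ^ m n\<close>, so the output length is still \<open>m n\<close>.\<close>
  define E where "E n x \<alpha> = str_of_nat (2 ^ m n - 1 +
    F d n (Suc (code x) - 2 ^ n) (Suc (code \<alpha>) - 2 ^ h n))" for n x \<alpha>
  have "computable_ensemble E"
  proof -
    obtain G where "\<And>n x a. evals G [n, x, a]
        (2 ^ m n - 1 + F d n (Suc x - 2 ^ n) (Suc a - 2 ^ h n))"
    proof (rule computable3)
      show "computable_nat (\<lambda>w. 2 ^ m (pfst w) - 1 + F d (pfst w) (Suc (pfst (psnd w)) - 2 ^ pfst w)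
          (Suc (psnd (psnd w)) - 2 ^ h (pfst w)))"
        by (intro comp_F computable_intros computable_comp[OF assms(2)] computable_comp[OF assms(3)])
    qed blast
    then show ?thesis unfolding computable_ensemble_def E_def by (auto intro!: exI[of _ G])
  qed
  moreover have "length (E n x \<alpha>) = m n" for n x \<alpha>
    unfolding E_def F_def by (intro length_str_of_nat table_less)
  moreover have incompressible: "\<exists>\<alpha>. length \<alpha> = h n \<and>
      real (kolmogorov U (E n x \<alpha>) (str_of_nat (m n))) \<ge> real (m n) - real (lo d n)"
    if x: "length x = n" and complex: "kolmogorov U x (str_of_nat n) \<ge> m n" for n x
  proof (rule ccontr)
    assume contra: "\<not> ?thesis"
    define i where "i = Suc (code x) - 2 ^ n"
    have i: "i < 2 ^ n" "2 ^ n - 1 + i = code x"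
      using x unfolding length_eq_iff i_def by auto
    have "F d n i a \<in> simple d n" if "a < 2 ^ h n" for a
    proof -
      define \<alpha> where "\<alpha> = str_of_nat (2 ^ h n - 1 + a)"
      have "length \<alpha> = h n" unfolding \<alpha>_def using that by (rule length_str_of_nat)
      then have "real (kolmogorov U (E n x \<alpha>) (str_of_nat (m n))) < real (m n) - real (lo d n)"
        using contra by force
      \<comment> \<open>The strict inequality over the reals forces \<open>lo d n < m n\<close>, so
        the difference is not truncated.\<close>
      then have "kolmogorov U (E n x \<alpha>) (str_of_nat (m n)) < m n - lo d n" by linarith
      moreover have "E n x \<alpha> = str_of_nat (2 ^ m n - 1 + F d n i a)"
        by (simp add: E_def \<alpha>_def i_def)
      ultimately show ?thesis by (simp add: simple_def F_def table_less)
    qed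
    then have "\<exists>s. adm d n s i" unfolding adm_iff by blast
    from enumerated_ex[of i "2 ^ n" "adm d n", OF i(1) this] obtain j w where
      j: "j < card {i. i < 2 ^ n \<and> (\<exists>s. adm d n s i)}" and w: "enumerated (2 ^ n) (adm d n) j w" "w mod 2 ^ n = i"
      by blast
    have "inj (\<lambda>y. str_of_nat (2 ^ m n - 1 + y))"
      by (rule injI) (metis code_str_of_nat add_left_cancel)
    from card_simple_less[OF assms(1) this] have "card (simple d n) < 2 ^ (m n - lo d n)"
      unfolding simple_def .
    then have le: "card {i. i < 2 ^ n \<and> (\<exists>s. adm d n s i)} * 2 ^ d \<le> 2 ^ m n"
      unfolding adm_iff F_def lo_def
      by (intro dispersesD[OF disperses_best_table]) (auto simp: simple_def)
    have "Suc j * 2 ^ d \<le> card {i. i < 2 ^ n \<and> (\<exists>s. adm d n s i)} * 2 ^ d"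
      using j by (intro mult_le_mono1) simp
    with le have jd: "Suc j * 2 ^ d \<le> 2 ^ m n" by linarith
    \<comment> \<open>A single trapped input already forces \<open>d \<le> m n\<close>, which lets
      the decoder recover \<open>d\<close> as \<open>m n - (m n - d)\<close>.\<close>
    then have "(2::nat) ^ d \<le> 2 ^ m n" unfolding mult_Suc by linarith
    then have dm: "d \<le> m n" by (rule power_le_imp_le_exp[rotated]) simp
    then have "(2::nat) ^ m n = 2 ^ (m n - d) * 2 ^ d" by (simp flip: power_add)
    with jd have "Suc j * 2 ^ d \<le> 2 ^ (m n - d) * 2 ^ d" by (simp only:)
    then have "j < 2 ^ (m n - d)" by (subst (asm) mult_le_cancel2) simp
    \<comment> \<open>The index is padded to exactly \<open>m n - d\<close> bits, because the
      decoder reads \<open>d\<close> off the length.\<close>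
    define p where "p = str_of_nat (2 ^ (m n - d) - 1 + j)"
    have len_p: "length p = m n - d" unfolding p_def by (rule length_str_of_nat) fact
    have "len (code p) = m n - d" by (simp add: len_code len_p)
    then have Q: "Q v (code p) n \<longleftrightarrow> enumerated (2 ^ n) (adm d n) j v" for v
      using dm unfolding Q_def by (simp add: p_def)
    then have "Q w (code p) n" using w by simp
    moreover have "(LEAST v. Q v (code p) n) = w"
    proof (rule Least_equality)
      show "w \<le> v" if "Q v (code p) n" for v
        using enumerated_inj[OF that[unfolded Q] w(1)] by simp
    qed fact
    ultimately have "M p (str_of_nat n) = Some x"
      using w(2) i(2) unfolding M_def by auto
    from c[OF this] obtain q where "length q \<le> m n - d + c" "U q (str_of_nat n) = Some x"
      unfolding len_p by blast
    then have "kolmogorov U x (str_of_nat n) < m n"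
      using dm unfolding kolmogorov_less_iff[OF assms(1)] d_def by (intro exI[of _ q]) auto
    with complex show False by simp
  qed
  moreover have "(\<lambda>n. real (lo d n)) \<in> o(\<lambda>n. real (m n))"
    unfolding lo_def using assms(4,5) by (rule loss_smallo)
  ultimately show ?thesis
    by (intro exI[of _ E] conjI bexI[of _ "\<lambda>n. real (lo d n)"] allI impI incompressible) simp_all
qed

end
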